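(* Let $q$ be a prime power, let $V$ and $W$ be finite-dimensional vector spaces over $\mathbb{F}_q$ with $m=\dim(V)$ and $n=\dim(W)$, let $d \in \mathbb{N}$, let $f:\mathcal{L}(V,W)\to \mathbb{C}$ be a function of degree $d$, and let $k \geq 4$ be an even integer. Then $$\mathbb{E}\left[|f^{(=d)}|^k\right]\leq k^7d^6\, q^{k^3d^2/2}\, q^{(3k/4-1)d\max\{m,n\}} \left(\sum_{\substack{V'\leq V:\\ \dim(V') = d}}\left\Vert \Pi_{V'}(f)\right\Vert _{2}^{k} + \sum_{\substack{W'\leq W:\\ \mathrm{codim}(W') = d}} \left\Vert \Pi_{W'}(f)\right\Vert _{2}^{k}\right).$$
   Context: $\mathcal{L}(V,W)$ is the space of linear maps from $V$ to $W$, equipped with the uniform probability measure; $\mathbb{E}$ is expectation with respect to it and $\|g\|_2=(\mathbb{E}[|g|^2])^{1/2}$. Write $q=p^s$ with $p$ prime, let $\tau:\mathbb{F}_q\to\mathbb{F}_p$, $\tau(x)=x+x^p+\cdots+x^{p^{s-1}}$, and let $\omega=\exp(2\pi i/p)$. For $X\in\mathcal{L}(W,V)$ define $u_X:\mathcal{L}(V,W)\to\mathbb{C}$ by $u_X(A)=\omega^{\tau(\mathrm{Trace}(XA))}$. These are the characters of the additive group $\mathcal{L}(V,W)$ and form an orthonormal basis, so each $f:\mathcal{L}(V,W)\to\mathbb{C}$ has the Fourier expansion $f=\sum_{X\in\mathcal{L}(W,V)}\hat f(X)u_X$, where $\hat f(X)=q^{-mn}\sum_{\sigma\in\mathcal{L}(V,W)}f(\sigma)\overline{u_X(\sigma)}$.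 The degree of $f$ is $\max\{\mathrm{rank}(X):\hat f(X)\neq 0\}$. Define $$f^{(=d)}=\sum_{X\in\mathcal{L}(W,V):\ \mathrm{rank}(X)=d}\hat f(X)u_X,$$ for a subspace $V'\leq V$, $\Pi_{V'}(f)=\sum_{X\in\mathcal{L}(W,V):\ \mathrm{im}(X)=V'}\hat f(X)u_X$, and for a subspace $W'\leq W$, $\Pi_{W'}(f)=\sum_{X\in\mathcal{L}(W,V):\ \ker(X)=W'}\hat f(X)u_X$. *)

theory Defs
  imports "HOL-Probability.Probability_Mass_Function"
begin

text \<open>
  Throughout, \<open>'k\<close> is a finite field with \<open>q = CARD('k) = p ^ s\<close>, and \<open>V\<close> and \<open>W\<close> are the
  vector spaces over \<open>'k\<close> carried by the types \<open>'v\<close> and \<open>'w\<close>, with scalar multiplications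
  \<open>sV\<close> and \<open>sW\<close>. A finite basis \<open>BV\<close> of \<open>V\<close> is passed along only to express the trace, which
  does not depend on it. A function on \<open>\<L>(V, W)\<close> is a function on \<open>'v \<Rightarrow> 'w\<close> whose values
  outside \<open>linear_maps sV sW\<close> are never used.
\<close>

definition linear_maps ::
    "('k::field \<Rightarrow> 'v::ab_group_add \<Rightarrow> 'v) \<Rightarrow> ('k \<Rightarrow> 'w::ab_group_add \<Rightarrow> 'w) \<Rightarrow> ('v \<Rightarrow> 'w) set"
  where "linear_maps sV sW = {A. Vector_Spaces.linear sV sW A}"

definition rank_of :: "('k::field \<Rightarrow> 'v::ab_group_add \<Rightarrow> 'v) \<Rightarrow> ('w \<Rightarrow> 'v) \<Rightarrow> nat"
  where "rank_of sV X = vector_space.dim sV (range X)"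

text \<open>The sum of the diagonal entries of the matrix of \<open>T\<close> with respect to the basis \<open>B\<close>.\<close>

definition trace_of ::
    "('k::field \<Rightarrow> 'v::ab_group_add \<Rightarrow> 'v) \<Rightarrow> 'v set \<Rightarrow> ('v \<Rightarrow> 'v) \<Rightarrow> 'k"
  where "trace_of sV B T = (\<Sum>b\<in>B. module.representation sV B (T b) b)"

definition field_trace :: "nat \<Rightarrow> nat \<Rightarrow> 'k::field \<Rightarrow> 'k"
  where "field_trace p s x = (\<Sum>i<s. x ^ (p ^ i))"

text \<open>
  The prime field is the set of all \<open>of_nat j\<close> in \<open>'k\<close>; the least such \<open>j\<close> is the standard
  representative in \<open>{0..<p}\<close>, used as the exponent of \<open>\<omega>\<close>.
\<close>

definition prime_field_rep :: "'k::field \<Rightarrow> nat"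
  where "prime_field_rep t = (LEAST j. of_nat j = t)"

definition fourier_char ::
    "nat \<Rightarrow> nat \<Rightarrow> ('k::field \<Rightarrow> 'v::ab_group_add \<Rightarrow> 'v) \<Rightarrow> 'v set
      \<Rightarrow> ('w \<Rightarrow> 'v) \<Rightarrow> ('v \<Rightarrow> 'w) \<Rightarrow> complex"
  where "fourier_char p s sV BV X A =
    exp (2 * of_real pi * \<i> / of_nat p)
      ^ prime_field_rep (field_trace p s (trace_of sV BV (X \<circ> A)))"

definition fourier_coeff ::
    "nat \<Rightarrow> nat \<Rightarrow> ('k::{field,finite} \<Rightarrow> 'v::ab_group_add \<Rightarrow> 'v) \<Rightarrow> 'v set
      \<Rightarrow> ('k \<Rightarrow> 'w::ab_group_add \<Rightarrow> 'w) \<Rightarrow> (('v \<Rightarrow> 'w) \<Rightarrow> complex) \<Rightarrow> ('w \<Rightarrow> 'v) \<Rightarrow> complex"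
  where "fourier_coeff p s sV BV sW f X =
    (\<Sum>A\<in>linear_maps sV sW. f A * cnj (fourier_char p s sV BV X A))
      / of_nat (CARD('k) ^ (vector_space.dim sV (UNIV :: 'v set) * vector_space.dim sW (UNIV :: 'w set)))"

text \<open>Inserting \<open>0\<close> only matters for the zero function, which gets degree \<open>0\<close>.\<close>

definition fourier_degree ::
    "nat \<Rightarrow> nat \<Rightarrow> ('k::{field,finite} \<Rightarrow> 'v::ab_group_add \<Rightarrow> 'v) \<Rightarrow> 'v set
      \<Rightarrow> ('k \<Rightarrow> 'w::ab_group_add \<Rightarrow> 'w) \<Rightarrow> (('v \<Rightarrow> 'w) \<Rightarrow> complex) \<Rightarrow> nat"
  where "fourier_degree p s sV BV sW f =
    Max (insert 0 (rank_of sV ` {X \<in> linear_maps sW sV. fourier_coeff p s sV BV sW f X \<noteq> 0}))"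

definition level_part ::
    "nat \<Rightarrow> nat \<Rightarrow> ('k::{field,finite} \<Rightarrow> 'v::ab_group_add \<Rightarrow> 'v) \<Rightarrow> 'v set
      \<Rightarrow> ('k \<Rightarrow> 'w::ab_group_add \<Rightarrow> 'w) \<Rightarrow> nat \<Rightarrow> (('v \<Rightarrow> 'w) \<Rightarrow> complex)
      \<Rightarrow> ('v \<Rightarrow> 'w) \<Rightarrow> complex"
  where "level_part p s sV BV sW d f A =
    (\<Sum>X | X \<in> linear_maps sW sV \<and> rank_of sV X = d.
      fourier_coeff p s sV BV sW f X * fourier_char p s sV BV X A)"

definition image_part ::
    "nat \<Rightarrow> nat \<Rightarrow> ('k::{field,finite} \<Rightarrow> 'v::ab_group_add \<Rightarrow> 'v) \<Rightarrow> 'v set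
      \<Rightarrow> ('k \<Rightarrow> 'w::ab_group_add \<Rightarrow> 'w) \<Rightarrow> 'v set \<Rightarrow> (('v \<Rightarrow> 'w) \<Rightarrow> complex)
      \<Rightarrow> ('v \<Rightarrow> 'w) \<Rightarrow> complex"
  where "image_part p s sV BV sW V' f A =
    (\<Sum>X | X \<in> linear_maps sW sV \<and> range X = V'.
      fourier_coeff p s sV BV sW f X * fourier_char p s sV BV X A)"

definition kernel_part ::
    "nat \<Rightarrow> nat \<Rightarrow> ('k::{field,finite} \<Rightarrow> 'v::ab_group_add \<Rightarrow> 'v) \<Rightarrow> 'v set
      \<Rightarrow> ('k \<Rightarrow> 'w::ab_group_add \<Rightarrow> 'w) \<Rightarrow> 'w set \<Rightarrow> (('v \<Rightarrow> 'w) \<Rightarrow> complex)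
      \<Rightarrow> ('v \<Rightarrow> 'w) \<Rightarrow> complex"
  where "kernel_part p s sV BV sW W' f A =
    (\<Sum>X | X \<in> linear_maps sW sV \<and> {w. X w = 0} = W'.
      fourier_coeff p s sV BV sW f X * fourier_char p s sV BV X A)"

definition mean ::
    "('k::field \<Rightarrow> 'v::ab_group_add \<Rightarrow> 'v) \<Rightarrow> ('k \<Rightarrow> 'w::ab_group_add \<Rightarrow> 'w)
      \<Rightarrow> (('v \<Rightarrow> 'w) \<Rightarrow> real) \<Rightarrow> real"
  where "mean sV sW g = measure_pmf.expectation (pmf_of_set (linear_maps sV sW)) g"

definition norm2 ::
    "('k::field \<Rightarrow> 'v::ab_group_add \<Rightarrow> 'v) \<Rightarrow> ('k \<Rightarrow> 'w::ab_group_add \<Rightarrow> 'w)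
      \<Rightarrow> (('v \<Rightarrow> 'w) \<Rightarrow> complex) \<Rightarrow> real"
  where "norm2 sV sW g = sqrt (mean sV sW (\<lambda>A. (cmod (g A))\<^sup>2))"

end

theory Submission
  imports Defs
begin

text \<open>
  Expanding \<open>|f\<^sup>(\<^sup>=\<^sup>d\<^sup>)|\<^sup>k\<close> into characters leaves the \<open>k\<close>-tuples of rank-\<open>d\<close> maps with \<open>\<Sum>i<k. \<plusminus> X\<^sub>i = 0\<close>.
  Write \<open>X\<^sub>i = \<Sum>j<d. T\<^sub>i\<^sub>j \<otimes> S\<^sub>i\<^sub>j\<close> with \<open>T\<^sub>i\<close> and \<open>S\<^sub>i\<close> linearly independent. If \<open>r\<close> of the \<open>N = k d\<close> vectors
  \<open>T\<^sub>i\<^sub>j\<close> span the others, then the vanishing of the sum expresses \<open>r\<close> of the \<open>S\<^sub>i\<^sub>j\<close> by the other \<open>N - r\<close>; the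
  coefficients involved (the pattern) take at most \<open>2\<^sup>N q\<^sup>N\<^sup>*\<^sup>N\<close> values. For a fixed pattern and \<open>r \<le> N / 2\<close>,
  Cauchy-Schwarz over \<open>S\<close> costs \<open>|W|\<close> to the power \<open>(N - r) / 2\<close> and turns the coefficients with image spanned by
  \<open>T\<^sub>i\<close> into \<open>\<Pi>_V'(f)\<close> norms; bounding the product over \<open>i\<close> by a sum of \<open>k\<close>-th powers then costs \<open>|V|\<close> to the
  power \<open>r - d\<close>, and \<open>(N - r) / 2 + r - d \<le> (3 k / 4 - 1) d\<close>. For \<open>r > N / 2\<close> the roles of \<open>V\<close> and \<open>W\<close>
  are exchanged and the kernels take the place of the images.
\<close>

section \<open>Vector spaces over a finite field\<close>

locale finite_field_space = finite_dimensional_vector_space scale Basis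
  for scale :: "'k::{field,finite} \<Rightarrow> 'v::ab_group_add \<Rightarrow> 'v" (infixr "\<cdot>" 75)
    and Basis :: "'v set"
begin

section \<open>Sizes of spans and subspaces\<close>

lemma card_span:
  assumes "finite B" "independent B"
  shows "finite (span B)" "card (span B) = CARD('k) ^ card B"
proof -
  let ?f = "\<lambda>c. \<Sum>b\<in>B. c b \<cdot> b"
  have img: "span B = ?f ` (B \<rightarrow>\<^sub>E UNIV)"
  proof -
    have "?f u \<in> ?f ` (B \<rightarrow>\<^sub>E UNIV)" for u
      by (rule image_eqI[of _ _ "restrict u B"]) (auto intro: sum.cong)
    then show ?thesis using span_finite[OF assms(1)] by auto
  qed
  have inj: "inj_on ?f (B \<rightarrow>\<^sub>E UNIV)"
  proof (rule inj_onI)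
    fix u v assume u: "u \<in> B \<rightarrow>\<^sub>E UNIV" and v: "v \<in> B \<rightarrow>\<^sub>E (UNIV::'k set)" and eq: "?f u = ?f v"
    have "(\<Sum>b\<in>B. (u b - v b) \<cdot> b) = 0"
      using eq by (simp add: scale_left_diff_distrib sum_subtractf)
    then have "u b - v b = 0" if "b \<in> B" for b
      using independentD[OF assms(2,1) order_refl, of "\<lambda>b. u b - v b"] that by auto
    then show "u = v" using u v by (intro PiE_ext[OF u v]) auto
  qed
  show "finite (span B)" unfolding img using assms(1) by (intro finite_imageI finite_PiE) auto
  show "card (span B) = CARD('k) ^ card B"
    unfolding img card_image[OF inj] using assms(1) by (simp add: card_PiE)
qed

lemma finite_carrier: "finite (UNIV :: 'v set)"
  using card_span(1)[OF finite_Basis independent_Basis] span_Basis by simp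

lemma card_subspace:
  assumes "subspace S"
  shows "card S = CARD('k) ^ dim S"
proof -
  obtain B where B: "B \<subseteq> S" "independent B" "S \<subseteq> span B" "card B = dim S"
    using basis_exists[of S] by metis
  then have "span B = S" using assms span_subspace by blast
  then show ?thesis using card_span(2)[of B] B finiteI_independent by metis
qed

lemma card_carrier: "CARD('v) = CARD('k) ^ dim (UNIV :: 'v set)"
  by (rule card_subspace) simp

section \<open>Independence of families, where a repeated vector counts as a dependence\<close>

definition indep_family :: "nat \<Rightarrow> (nat \<Rightarrow> 'v) \<Rightarrow> bool"
  where "indep_family d x \<longleftrightarrow> (\<forall>c. (\<Sum>j<d. c j \<cdot> x j) = 0 \<longrightarrow> (\<forall>j<d. c j = 0))"

lemma indep_family_unique:
  assumes "indep_family d x" "(\<Sum>j<d. a j \<cdot> x j) = (\<Sum>j<d. b j \<cdot> x j)" "j < d"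
  shows "a j = b j"
proof -
  have "(\<Sum>j<d. (a j - b j) \<cdot> x j) = 0"
    using assms(2) by (simp add: scale_left_diff_distrib sum_subtractf)
  then have "a j - b j = 0" 
    using assms(1,3) unfolding indep_family_def by (elim allE[of _ "\<lambda>j. a j - b j"]) auto
  then show ?thesis by simp
qed

lemma indep_family_inj:
  assumes "indep_family d x"
  shows "inj_on x {..<d}"
proof (rule inj_onI)
  fix i j assume ij: "i \<in> {..<d}" "j \<in> {..<d}" "x i = x j"
  have *: "(\<Sum>l<d. (if l = i then 1 else 0) \<cdot> x l) = x i" if "i < d" for i
    using that by (simp add: if_distrib[of "\<lambda>c. c \<cdot> _"] cong: if_cong)
  have "(if i = i then 1 else 0) = (if i = j then 1 else (0::'k))"
    using ij by (intro indep_family_unique[OF assms, of "\<lambda>l. if l = i then 1 else 0" "\<lambda>l. if l = j then 1 else 0" i])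
       (auto simp: *)
  then show "i = j" by (auto split: if_splits)
qed

lemma indep_family_independent:
  assumes "indep_family d x"
  shows "independent (x ` {..<d})"
proof
  assume "dependent (x ` {..<d})"
  then obtain u v where u: "v \<in> x ` {..<d}" "u v \<noteq> 0" "(\<Sum>v\<in>x ` {..<d}. u v \<cdot> v) = 0"
    using dependent_finite[of "x ` {..<d}"] by auto
  then have "(\<Sum>j<d. u (x j) \<cdot> x j) = 0"
    by (simp add: sum.reindex[OF indep_family_inj[OF assms]])
  then show False using assms u unfolding indep_family_def by (elim allE[of _ "u \<circ> x"]) auto
qed

lemma indep_familyI:
  assumes "inj_on x {..<d}" "independent (x ` {..<d})"
  shows "indep_family d x"
  unfolding indep_family_def
proof (intro allI impI)
  fix c j assume c: "(\<Sum>j<d. c j \<cdot> x j) = 0" and j: "j < d"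
  let ?u = "\<lambda>v. c (the_inv_into {..<d} x v)"
  have "(\<Sum>v\<in>x ` {..<d}. ?u v \<cdot> v) = (\<Sum>j<d. c j \<cdot> x j)"
    using assms(1) by (simp add: sum.reindex the_inv_into_f_f)
  then have "?u (x j) = 0" using c j by (intro independentD[OF assms(2), of "x ` {..<d}"]) auto
  then show "c j = 0" using j assms(1) by (simp add: the_inv_into_f_f)
qed

lemma indep_family_dim_span:
  assumes "indep_family d x"
  shows "dim (span (x ` {..<d})) = d"
  using dim_span_eq_card_independent[OF indep_family_independent[OF assms]]
    card_image[OF indep_family_inj[OF assms]] by simp

lemma indep_family_extend:
  assumes "indep_family d x"
  shows "\<exists>h. Vector_Spaces.linear scale scale h \<and> (\<forall>j<d. h (x j) = y j)"
proof -
  interpret vector_space_pair scale scale by unfold_locales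
  obtain h where h: "Vector_Spaces.linear scale scale h"
    "\<forall>v \<in> x ` {..<d}. h v = y (the_inv_into {..<d} x v)"
    using linear_independent_extend[OF indep_family_independent[OF assms],
      where f="\<lambda>v. y (the_inv_into {..<d} x v)"] by auto
  show ?thesis
    using h indep_family_inj[OF assms] by (intro exI[of _ h]) (auto simp: the_inv_into_f_f)
qed

section \<open>Tables of vectors obeying a fixed linear pattern\<close>

abbreviation tuples :: "nat \<Rightarrow> (nat \<Rightarrow> 'v) set"
  where "tuples d \<equiv> {..<d} \<rightarrow>\<^sub>E UNIV"

abbreviation tables :: "nat \<Rightarrow> nat \<Rightarrow> (nat \<Rightarrow> nat \<Rightarrow> 'v) set"
  where "tables k d \<equiv> {..<k} \<rightarrow>\<^sub>E tuples d"

lemma finite_tuples: "finite (tuples d)"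
  using finite_carrier by (intro finite_PiE) auto

lemma finite_tables: "finite (tables k d)"
  by (rule finite_PiE) (simp_all add: finite_tuples)

lemma card_tuples: "card (tuples d) = CARD('v) ^ d"
  by (simp add: card_PiE)

lemma tables_ext:
  assumes "T \<in> tables k d" "T' \<in> tables k d" "\<And>i j. i < k \<Longrightarrow> j < d \<Longrightarrow> T i j = T' i j"
  shows "T = T'"
proof (rule PiE_ext[OF assms(1,2)])
  fix i assume i: "i \<in> {..<k}"
  then have "T i \<in> tuples d" "T' i \<in> tuples d" using assms(1,2) by (blast dest: PiE_mem)+
  then show "T i = T' i" by (rule PiE_ext) (use i assms(3) in auto)
qed

text \<open>The solutions of a homogeneous linear system. The entries at \<open>R\<close> determine
  the table, but they need not be independent and \<open>e\<close> may impose relations among them,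
  so \<open>card R\<close> bounds the number of solutions without fixing it.\<close>

definition pattern_tables ::
    "nat \<Rightarrow> nat \<Rightarrow> (nat \<times> nat) set \<Rightarrow> ((nat \<times> nat) \<times> nat \<times> nat \<Rightarrow> 'k) \<Rightarrow> (nat \<Rightarrow> nat \<Rightarrow> 'v) set"
  where "pattern_tables k d R e = {T \<in> tables k d.
    \<forall>i<k. \<forall>j<d. T i j = (\<Sum>r\<in>R. e ((i, j), r) \<cdot> T (fst r) (snd r))}"

lemma finite_pattern_tables: "finite (pattern_tables k d R e)"
  unfolding pattern_tables_def using finite_tables by simp

lemma card_pattern_tables_le:
  assumes "R \<subseteq> {..<k} \<times> {..<d}"
  shows "card (pattern_tables k d R e) \<le> CARD('v) ^ card R"
proof -
  have fR: "finite R" using assms finite_subset by blast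
  let ?f = "\<lambda>T. restrict (\<lambda>r. T (fst r) (snd r)) R"
  have "card (pattern_tables k d R e) \<le> card (R \<rightarrow>\<^sub>E (UNIV::'v set))"
  proof (rule card_inj_on_le[of ?f])
    show "inj_on ?f (pattern_tables k d R e)"
    proof (rule inj_onI)
      fix T T' assume T: "T \<in> pattern_tables k d R e" and T': "T' \<in> pattern_tables k d R e"
        and eq: "?f T = ?f T'"
      have "T (fst r) (snd r) = T' (fst r) (snd r)" if "r \<in> R" for r
        using fun_cong[OF eq, of r] that by simp
      then have "T i j = T' i j" if "i < k" "j < d" for i j
        using T T' that unfolding pattern_tables_def by auto
      then show "T = T'" using T T' unfolding pattern_tables_def
        by (intro tables_ext[of T k d T']) auto
    qed
  qed (use fR finite_carrier in \<open>auto intro!: finite_PiE\<close>)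
  then show ?thesis using fR by (simp add: card_PiE)
qed

text \<open>A pattern is preserved by applying a linear map to all entries, so once row \<open>i\<close> takes an
  independent value it takes every value, each of them equally often.\<close>

lemma sum_pattern_tables_row_le:
  fixes h :: "(nat \<Rightarrow> 'v) \<Rightarrow> real"
  assumes R: "R \<subseteq> {..<k} \<times> {..<d}" and i: "i < k"
    and nonneg: "\<And>x. 0 \<le> h x"
    and supp: "\<And>x. h x \<noteq> 0 \<Longrightarrow> indep_family d x"
  shows "(\<Sum>T\<in>pattern_tables k d R e. h (T i)) \<le> real CARD('v) ^ (card R - d) * (\<Sum>x\<in>tuples d. h x)"
proof (cases "\<exists>T\<in>pattern_tables k d R e. indep_family d (T i)")
  case False
  then have "(\<Sum>T\<in>pattern_tables k d R e. h (T i)) = 0"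
    using supp by (intro sum.neutral) blast
  then show ?thesis using nonneg by (simp add: sum_nonneg)
next
  case True
  let ?P = "pattern_tables k d R e"
  define F where "F y = {T \<in> ?P. T i = y}" for y
  from True obtain T0 where T0: "T0 \<in> ?P" "indep_family d (T0 i)" by blast
  have fR: "finite R" using R finite_subset by blast
  have fF: "finite (F y)" for y unfolding F_def using finite_pattern_tables by simp
  have R_D: "fst r < k" "snd r < d" if "r \<in> R" for r using R that by auto
  have P_D: "T \<in> tables k d" if "T \<in> ?P" for T using that unfolding pattern_tables_def by blast
  have P_eq: "T a b = (\<Sum>r\<in>R. e ((a, b), r) \<cdot> T (fst r) (snd r))"
    if "T \<in> ?P" "a < k" "b < d" for T a b
    using that unfolding pattern_tables_def by blast
  \<comment> \<open>The independent row lies in the span of the \<open>card R\<close> entries at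
    \<open>R\<close>. Hence the subtraction in \<open>card R - d\<close> is not truncated.\<close>
  have dR: "d \<le> card R"
  proof -
    let ?S = "(\<lambda>r. T0 (fst r) (snd r)) ` R"
    have "T0 i j \<in> span ?S" if "j < d" for j
      unfolding P_eq[OF T0(1) i that] by (intro span_sum span_scale span_base) auto
    then have "card (T0 i ` {..<d}) \<le> card ?S"
      using independent_span_bound[OF _ indep_family_independent[OF T0(2)], of ?S] fR by auto
    also have "\<dots> \<le> card R" by (rule card_image_le[OF fR])
    finally show ?thesis by (simp add: card_image[OF indep_family_inj[OF T0(2)]])
  qed
  \<comment> \<open>Every value \<open>y\<close> of row \<open>i\<close> occurs: a linear map
    sending \<open>T0 i j\<close> to \<open>y j\<close>, applied to all entries of
    \<open>T0\<close>, respects the pattern.\<close>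
  have nonempty: "\<exists>T. T \<in> F y" if y: "y \<in> tuples d" for y
  proof -
    obtain g where g: "Vector_Spaces.linear scale scale g" "\<forall>j<d. g (T0 i j) = y j"
      using indep_family_extend[OF T0(2), of y] by blast
    interpret g: Vector_Spaces.linear scale scale g by (rule g(1))
    let ?T = "\<lambda>a\<in>{..<k}. \<lambda>b\<in>{..<d}. g (T0 a b)"
    have "?T a b = (\<Sum>r\<in>R. e ((a, b), r) \<cdot> ?T (fst r) (snd r))" if "a < k" "b < d" for a b
    proof -
      have "?T a b = g (\<Sum>r\<in>R. e ((a, b), r) \<cdot> T0 (fst r) (snd r))"
        using that P_eq[OF T0(1) that] by simp
      also have "\<dots> = (\<Sum>r\<in>R. e ((a, b), r) \<cdot> ?T (fst r) (snd r))"
        using R_D by (auto simp: g.sum g.scale intro!: sum.cong)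
      finally show ?thesis .
    qed
    then have "?T \<in> ?P"
      unfolding pattern_tables_def by (intro CollectI conjI allI impI) auto
    moreover have "?T i = y"
      using y g(2) i by (intro PiE_ext[of _ "{..<d}" "\<lambda>_. UNIV"]) auto
    ultimately show ?thesis unfolding F_def by blast
  qed
  \<comment> \<open>Any two fibres are translates of each other by \<open>Tz - Ty\<close>, because
    the pattern is linear. As \<open>y\<close> and \<open>z\<close> are arbitrary, all fibres have
    the same size.\<close>
  have le: "card (F y) \<le> card (F z)" if y: "y \<in> tuples d" and z: "z \<in> tuples d" for y z
  proof -
    obtain Ty Tz where Ty: "Ty \<in> F y" and Tz: "Tz \<in> F z" using nonempty[OF y] nonempty[OF z] by blast
    let ?g = "\<lambda>T. \<lambda>a\<in>{..<k}. \<lambda>b\<in>{..<d}. T a b - Ty a b + Tz a b"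
    show ?thesis
    proof (rule card_inj_on_le[of ?g])
      show "inj_on ?g (F y)"
      proof (rule inj_onI)
        fix T T' assume T: "T \<in> F y" "T' \<in> F y" and eq: "?g T = ?g T'"
        have "T a b = T' a b" if "a < k" "b < d" for a b
        proof -
          have "?g T a b = ?g T' a b" by (simp only: eq)
          then show ?thesis using that by simp
        qed
        moreover have "T \<in> tables k d" "T' \<in> tables k d"
          using T P_D unfolding F_def by blast+
        ultimately show "T = T'" by (intro tables_ext[of T k d T'])
      qed
      show "?g ` F y \<subseteq> F z"
      proof (rule image_subsetI)
        fix T assume T: "T \<in> F y"
        have P: "T \<in> ?P" "Ty \<in> ?P" "Tz \<in> ?P" using T Ty Tz unfolding F_def by auto
        have eq: "?g T a b = (\<Sum>r\<in>R. e ((a, b), r) \<cdot> ?g T (fst r) (snd r))"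
          if ab: "a < k" "b < d" for a b
        proof -
          have "?g T a b = T a b - Ty a b + Tz a b" using ab by simp
          also have "\<dots> = (\<Sum>r\<in>R. e ((a, b), r) \<cdot>
              (T (fst r) (snd r) - Ty (fst r) (snd r) + Tz (fst r) (snd r)))"
            by (subst P_eq[OF P(1) ab], subst P_eq[OF P(2) ab], subst P_eq[OF P(3) ab])
              (simp add: scale_right_distrib scale_right_diff_distrib sum.distrib sum_subtractf)
          also have "\<dots> = (\<Sum>r\<in>R. e ((a, b), r) \<cdot> ?g T (fst r) (snd r))"
            by (intro sum.cong refl) (simp add: R_D)
          finally show ?thesis .
        qed
        have "Tz i \<in> tuples d" using P_D[OF P(3)] i by auto
        then have "?g T i = z"
          using T Ty Tz i z unfolding F_def
          by (intro PiE_ext[of _ "{..<d}" "\<lambda>_. UNIV"]) auto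
        moreover have "?g T \<in> ?P"
          unfolding pattern_tables_def by (intro CollectI conjI allI impI eq) auto
        ultimately show "?g T \<in> F z" unfolding F_def by blast
      qed
    qed (rule fF)
  qed
  have mem: "(\<lambda>T. T i) ` ?P \<subseteq> tuples d"
    by (intro image_subsetI PiE_mem[OF P_D]) (use i in auto)
  \<comment> \<open>The \<open>CARD('v) ^ d\<close> fibres of equal size share at most
    \<open>CARD('v) ^ card R\<close> tables.\<close>
  have cardF: "card (F y) \<le> CARD('v) ^ (card R - d)" if y: "y \<in> tuples d" for y
  proof -
    have "CARD('v) ^ d * card (F y) = (\<Sum>z\<in>tuples d. card (F y))" by (simp add: card_tuples)
    also have "\<dots> \<le> (\<Sum>z\<in>tuples d. card (F z))" by (intro sum_mono le y)
    also have "\<dots> = card ?P"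
      using sum.group[OF finite_pattern_tables finite_tuples mem, of "\<lambda>_. 1::nat"]
      unfolding F_def by simp
    also have "\<dots> \<le> CARD('v) ^ card R" by (rule card_pattern_tables_le[OF R])
    also have "\<dots> = CARD('v) ^ d * CARD('v) ^ (card R - d)" using dR by (simp flip: power_add)
    finally show ?thesis using finite_carrier by (simp add: card_gt_0_iff)
  qed
  have "(\<Sum>T\<in>?P. h (T i)) = (\<Sum>y\<in>tuples d. \<Sum>T\<in>F y. h (T i))"
    using sum.group[OF finite_pattern_tables finite_tuples mem, of "\<lambda>T. h (T i)"]
    unfolding F_def by simp
  also have "\<dots> = (\<Sum>y\<in>tuples d. real (card (F y)) * h y)"
    by (intro sum.cong) (auto simp: F_def)
  also have "\<dots> \<le> (\<Sum>y\<in>tuples d. real (CARD('v) ^ (card R - d)) * h y)"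
    using cardF nonneg by (intro sum_mono mult_right_mono) (auto simp: simp del: of_nat_power)
  finally show ?thesis by (simp add: sum_distrib_left)
qed

text \<open>Identifies the space with its dual, so that a linear map \<open>W \<Rightarrow> V\<close> of rank \<open>d\<close> becomes a sum of
  \<open>d\<close> terms \<open>pairing y_j w \<cdot> x_j\<close> with vectors on both sides.\<close>

definition pairing :: "'v \<Rightarrow> 'v \<Rightarrow> 'k"
  where "pairing v w = (\<Sum>b\<in>Basis. representation Basis v b * representation Basis w b)"

lemma rep_add: "representation Basis (v + w) b = representation Basis v b + representation Basis w b"
  by (simp add: representation_add independent_Basis span_Basis)

lemma rep_scale: "representation Basis (c \<cdot> v) b = c * representation Basis v b"
  by (simp add: representation_scale independent_Basis span_Basis)

lemma rep_sum: "representation Basis (\<Sum>i\<in>I. v i) b = (\<Sum>i\<in>I. representation Basis (v i) b)"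
  by (simp add: representation_sum independent_Basis span_Basis)

lemma sum_rep: "(\<Sum>b\<in>Basis. representation Basis v b \<cdot> b) = v"
  using sum_representation_eq[OF independent_Basis _ finite_Basis order_refl] span_Basis by simp

lemma pairing_add_right: "pairing v (w + w') = pairing v w + pairing v w'"
  by (simp add: pairing_def rep_add sum.distrib algebra_simps)

lemma pairing_scale_left: "pairing (c \<cdot> v) w = c * pairing v w"
  by (simp add: pairing_def rep_scale sum_distrib_left algebra_simps)

lemma pairing_scale_right: "pairing v (c \<cdot> w) = c * pairing v w"
  by (simp add: pairing_def rep_scale sum_distrib_left algebra_simps)

lemma pairing_sum_left: "pairing (\<Sum>i\<in>I. v i) w = (\<Sum>i\<in>I. pairing (v i) w)"
  unfolding pairing_def rep_sum sum_distrib_right by (rule sum.swap)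

lemma pairing_basis_left: "b \<in> Basis \<Longrightarrow> pairing b w = representation Basis w b"
  using finite_Basis
  by (simp add: pairing_def representation_basis independent_Basis if_distrib[of "\<lambda>c. c * _"] cong: if_cong)

lemma pairing_basis_right: "b \<in> Basis \<Longrightarrow> pairing v b = representation Basis v b"
  using finite_Basis
  by (simp add: pairing_def representation_basis independent_Basis if_distrib[of "\<lambda>c. _ * c"] cong: if_cong)

lemma pairing_eqI:
  assumes "\<And>w. pairing v w = pairing v' w"
  shows "v = v'"
proof -
  have "representation Basis v b = representation Basis v' b" if "b \<in> Basis" for b
    using assms[of b] that by (simp add: pairing_basis_right)
  then have "(\<Sum>b\<in>Basis. representation Basis v b \<cdot> b) = (\<Sum>b\<in>Basis. representation Basis v' b \<cdot> b)"
    by (intro sum.cong) auto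
  then show ?thesis by (simp add: sum_rep)
qed

lemma pairing_represents:
  assumes add: "\<And>v w. phi (v + w) = phi v + phi w"
    and scale: "\<And>c v. phi (c \<cdot> v) = c * (phi v :: 'k)"
  shows "\<exists>v. \<forall>w. pairing v w = phi w"
proof (intro exI allI)
  have phi0: "phi 0 = 0" using scale[of 0 0] by simp
  have phi_sum: "phi (\<Sum>b\<in>B. g b) = (\<Sum>b\<in>B. phi (g b))" for B and g :: "'v \<Rightarrow> 'v"
    by (induction B rule: infinite_finite_induct) (auto simp: add phi0)
  \<comment> \<open>The basis is orthonormal for the pairing, so the representing vector has the
    values of \<open>phi\<close> on the basis as its coordinates.\<close>
  show "pairing (\<Sum>b\<in>Basis. phi b \<cdot> b) w = phi w" for w
  proof -
    have "pairing (\<Sum>b\<in>Basis. phi b \<cdot> b) w = (\<Sum>b\<in>Basis. representation Basis w b * phi b)"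
      by (simp add: pairing_sum_left pairing_scale_left pairing_basis_left mult.commute)
    also have "\<dots> = phi (\<Sum>b\<in>Basis. representation Basis w b \<cdot> b)" by (simp add: phi_sum scale)
    finally show ?thesis by (simp add: sum_rep)
  qed
qed

end

section \<open>Counting tables with a linear relation\<close>

text \<open>Cauchy-Schwarz against the constant 1 on \<open>F\<close>. Only afterwards is
  \<open>F\<close> enlarged to the whole product, where the sum of squares factors over
  \<open>i\<close>; the size of \<open>F\<close> itself survives in the first factor.\<close>

lemma sum_prod_le_sqrt_card:
  fixes g :: "nat \<Rightarrow> 'a \<Rightarrow> real"
  assumes "finite Y" "F \<subseteq> {..<k} \<rightarrow>\<^sub>E Y" and nonneg: "\<And>i y. 0 \<le> g i y"
  shows "(\<Sum>S\<in>F. \<Prod>i<k. g i (S i)) \<le> sqrt (card F) * (\<Prod>i<k. sqrt (\<Sum>y\<in>Y. (g i y)\<^sup>2))"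
proof -
  have fin: "finite ({..<k} \<rightarrow>\<^sub>E Y)" using assms(1) by (intro finite_PiE) auto
  have "(\<Sum>S\<in>F. \<Prod>i<k. g i (S i)) = (\<Sum>S\<in>F. \<bar>1\<bar> * \<bar>\<Prod>i<k. g i (S i)\<bar>)"
    by (simp add: abs_of_nonneg prod_nonneg nonneg)
  also have "\<dots> \<le> L2_set (\<lambda>_. 1) F * L2_set (\<lambda>S. \<Prod>i<k. g i (S i)) F"
    by (rule L2_set_mult_ineq)
  also have "\<dots> = sqrt (card F) * sqrt (\<Sum>S\<in>F. \<Prod>i<k. (g i (S i))\<^sup>2)"
    by (simp add: L2_set_def prod_power_distrib)
  also have "\<dots> \<le> sqrt (card F) * sqrt (\<Sum>S\<in>{..<k} \<rightarrow>\<^sub>E Y. \<Prod>i<k. (g i (S i))\<^sup>2)"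
    using assms(2) fin
    by (intro mult_left_mono real_sqrt_le_mono sum_mono2) (auto intro: prod_nonneg)
  also have "(\<Sum>S\<in>{..<k} \<rightarrow>\<^sub>E Y. \<Prod>i<k. (g i (S i))\<^sup>2) = (\<Prod>i<k. \<Sum>y\<in>Y. (g i y)\<^sup>2)"
    using assms(1) by (subst prod_sum_PiE) auto
  also have "sqrt \<dots> = (\<Prod>i<k. sqrt (\<Sum>y\<in>Y. (g i y)\<^sup>2))"
    by (induction k) (auto simp: real_sqrt_mult)
  finally show ?thesis .
qed

text \<open>A crude form of the inequality of arithmetic and geometric means: the
  \<open>k\<close>-th power of the largest factor is one of the summands.\<close>

lemma prod_le_sum_power:
  fixes b :: "nat \<Rightarrow> real"
  assumes "k > 0" and nonneg: "\<And>i. 0 \<le> b i"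
  shows "(\<Prod>i<k. b i) \<le> (\<Sum>i<k. b i ^ k)"
proof -
  obtain j where j: "j < k" "\<And>i. i < k \<Longrightarrow> b i \<le> b j"
  proof -
    have "Max (b ` {..<k}) \<in> b ` {..<k}" using assms(1) by (intro Max_in) auto
    then obtain j where "j < k" "b j = Max (b ` {..<k})" by auto
    then show thesis by (intro that[of j]) auto
  qed
  have "(\<Prod>i<k. b i) \<le> (\<Prod>i<k. b j)" using j nonneg by (intro prod_mono) auto
  also have "\<dots> = b j ^ k" by simp
  also have "\<dots> \<le> (\<Sum>i<k. b i ^ k)" using j(1) nonneg by (intro member_le_sum) auto
  finally show ?thesis .
qed

context finite_field_space
begin

text \<open>For each \<open>T\<close> the sum over \<open>S\<close> is estimated by Cauchy-Schwarz,
  leaving a product of row norms. Bounding this by a sum of \<open>k\<close>-th powers separates the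
  rows, and each of the \<open>k\<close> rows is then equidistributed by
  \<open>sum_pattern_tables_row_le\<close>. The second factor is an arbitrary finite set, so that
  the lemma serves again with \<open>V\<close> and \<open>W\<close> exchanged.\<close>

lemma sum_pattern_tables_le:
  fixes a :: "(nat \<Rightarrow> 'v) \<Rightarrow> 'b \<Rightarrow> real"
  assumes R: "R \<subseteq> {..<k} \<times> {..<d}" and k: "k > 0"
    and Y: "finite Y" "F \<subseteq> {..<k} \<rightarrow>\<^sub>E Y"
    and nonneg: "\<And>x y. 0 \<le> a x y"
    and supp: "\<And>x y. a x y \<noteq> 0 \<Longrightarrow> indep_family d x"
  shows "(\<Sum>T\<in>pattern_tables k d R e. \<Sum>S\<in>F. \<Prod>i<k. a (T i) (S i))
    \<le> sqrt (card F) * (real k * (real CARD('v) ^ (card R - d)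
        * (\<Sum>x\<in>tuples d. sqrt (\<Sum>y\<in>Y. (a x y)\<^sup>2) ^ k)))"
proof -
  let ?b = "\<lambda>x. sqrt (\<Sum>y\<in>Y. (a x y)\<^sup>2)"
  have b: "indep_family d x" if "?b x ^ k \<noteq> 0" for x
  proof (rule ccontr)
    assume "\<not> indep_family d x"
    then have "a x y = 0" for y using supp by blast
    then show False using that k by (simp add: power_0_left)
  qed
  have b0: "0 \<le> ?b x" for x by (simp add: sum_nonneg)
  have "(\<Sum>T\<in>pattern_tables k d R e. \<Sum>S\<in>F. \<Prod>i<k. a (T i) (S i))
      \<le> (\<Sum>T\<in>pattern_tables k d R e. sqrt (card F) * (\<Prod>i<k. ?b (T i)))"
    by (intro sum_mono sum_prod_le_sqrt_card Y nonneg)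
  also have "\<dots> \<le> (\<Sum>T\<in>pattern_tables k d R e. sqrt (card F) * (\<Sum>i<k. ?b (T i) ^ k))"
    by (intro sum_mono mult_left_mono prod_le_sum_power k b0) simp
  also have "\<dots> = sqrt (card F) * (\<Sum>i<k. \<Sum>T\<in>pattern_tables k d R e. ?b (T i) ^ k)"
    by (simp add: sum_distrib_left[symmetric] sum.swap[of _ "pattern_tables k d R e"])
  also have "\<dots> \<le> sqrt (card F) * (\<Sum>i<k. real CARD('v) ^ (card R - d) * (\<Sum>x\<in>tuples d. ?b x ^ k))"
  proof (intro mult_left_mono sum_mono)
    fix i assume "i \<in> {..<k}"
    then show "(\<Sum>T\<in>pattern_tables k d R e. ?b (T i) ^ k)
        \<le> real CARD('v) ^ (card R - d) * (\<Sum>x\<in>tuples d. ?b x ^ k)"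
      using b b0 by (intro sum_pattern_tables_row_le[OF R]) auto
  qed simp
  finally show ?thesis by simp
qed

end

section \<open>Two spaces: a vanishing sum of tensors and its dual pattern\<close>

locale finite_field_space_pair =
  V: finite_field_space sV BV + W: finite_field_space sW BW
  for sV :: "'k::{field,finite} \<Rightarrow> 'v::ab_group_add \<Rightarrow> 'v" and BV
    and sW :: "'k \<Rightarrow> 'w::ab_group_add \<Rightarrow> 'w" and BW
begin

text \<open>The analogue of passing from a generator matrix \<open>[I | A]\<close> to the parity
  check matrix \<open>[-A^T | I]\<close>. Off \<open>R\<close> the entries are free. For
  \<open>s\<close> in \<open>R\<close> the relation, with \<open>e\<close> the identity on
  \<open>R\<close>, reads \<open>c_s S_s = - sum c_r e(r, s) S_r\<close> over \<open>r\<close>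
  outside \<open>R\<close>, which is solved for \<open>S_s\<close>.\<close>

definition dual_pattern ::
    "(nat \<Rightarrow> 'k) \<Rightarrow> (nat \<times> nat) set \<Rightarrow> ((nat \<times> nat) \<times> nat \<times> nat \<Rightarrow> 'k)
      \<Rightarrow> (nat \<times> nat) \<times> nat \<times> nat \<Rightarrow> 'k"
  where "dual_pattern c R e = (\<lambda>(s, r).
    if s \<in> R then - (c (fst r) / c (fst s)) * e (r, s) else if s = r then 1 else 0)"

text \<open>Take for \<open>R\<close> the positions of a basis of the span of the entries of \<open>T\<close>: comparing
  coefficients in that basis, the relation expresses the entries of \<open>S\<close> in \<open>R\<close> by the others.\<close>

lemma dual_patterns_exist:
  fixes k d :: nat
  defines "I \<equiv> {..<k} \<times> {..<d}"
  assumes T: "T \<in> V.tables k d" and S: "S \<in> W.tables k d" and c: "\<And>i. c i \<noteq> 0"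
    and rel: "\<And>w. (\<Sum>i<k. \<Sum>j<d. sV (c i * W.pairing (S i j) w) (T i j)) = 0"
  shows "\<exists>R\<in>Pow I. \<exists>e\<in>I \<times> I \<rightarrow>\<^sub>E UNIV.
    T \<in> V.pattern_tables k d R e \<and> S \<in> W.pattern_tables k d (I - R) (dual_pattern c R e)"
proof -
  let ?t = "\<lambda>r. T (fst r) (snd r)" and ?s = "\<lambda>r. S (fst r) (snd r)"
  obtain B where B: "B \<subseteq> ?t ` I" "V.independent B" "?t ` I \<subseteq> V.span B"
    using V.maximal_independent_subset[of "?t ` I"] by metis
  \<comment> \<open>One position is chosen for each basis vector, so that vectors occurring several
    times in the table are counted once and \<open>?t\<close> is injective on
    \<open>R\<close>.\<close>
  define R where "R = inv_into I ?t ` B"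
  have RI: "R \<subseteq> I"
    unfolding R_def by (intro image_subsetI inv_into_into) (use B(1) in blast)
  have fI: "finite I" unfolding I_def by simp
  have fR: "finite R" using RI fI finite_subset by blast
  have tinv: "?t (inv_into I ?t b) = b" if "b \<in> B" for b
    using B(1) that by (intro f_inv_into_f) blast
  have tR: "?t ` R = B" unfolding R_def using tinv by force
  have injR: "inj_on ?t R"
    by (rule inj_on_inverseI[of _ "inv_into I ?t"]) (auto simp only: R_def tinv)
  have "\<exists>u. ?t s = (\<Sum>r\<in>R. sV (u r) (?t r))" if "s \<in> I" for s
  proof -
    have "?t s \<in> V.span (?t ` R)" using that B(3) tR by auto
    then obtain u where "?t s = (\<Sum>v\<in>?t ` R. sV (u v) v)"
      using V.span_finite[of "?t ` R"] fR by auto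
    then show ?thesis
      by (intro exI[of _ "u \<circ> ?t"]) (simp add: sum.reindex[OF injR])
  qed
  then obtain u where u: "\<And>s. s \<in> I \<Longrightarrow> ?t s = (\<Sum>r\<in>R. sV (u s r) (?t r))" by metis
  \<comment> \<open>The coefficients are the identity on \<open>R\<close>, as the dual pattern
    requires. The restriction to \<open>I \<times> I\<close> places \<open>e\<close> in a finite set
    of candidates that can be counted.\<close>
  define e where "e = (\<lambda>sr\<in>I \<times> I. if fst sr \<in> R then (if fst sr = snd sr then 1 else 0)
    else u (fst sr) (snd sr))"
  have t_eq: "?t s = (\<Sum>r\<in>R. sV (e (s, r)) (?t r))" if s: "s \<in> I" for s
  proof (cases "s \<in> R")
    case True
    have "(\<Sum>r\<in>R. sV (e (s, r)) (?t r)) = (\<Sum>r\<in>R. if r = s then ?t r else 0)"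
      using RI s True by (intro sum.cong) (auto simp: e_def)
    then show ?thesis using True fR by simp
  next
    case False
    then have "(\<Sum>r\<in>R. sV (e (s, r)) (?t r)) = (\<Sum>r\<in>R. sV (u s r) (?t r))"
      using RI s by (intro sum.cong) (auto simp: e_def)
    then show ?thesis using u[OF s] by simp
  qed
  \<comment> \<open>After substituting the pattern of \<open>T\<close>, the relation is a linear
    combination of the independent vectors at \<open>R\<close>, so each coefficient
    vanishes.\<close>
  have coeff: "(\<Sum>s\<in>I. c (fst s) * e (s, r) * W.pairing (?s s) w) = 0" if r: "r \<in> R" for r w
  proof -
    let ?z = "\<lambda>r. \<Sum>s\<in>I. c (fst s) * W.pairing (?s s) w * e (s, r)"
    have "0 = (\<Sum>s\<in>I. sV (c (fst s) * W.pairing (?s s) w) (?t s))"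
      using rel[of w] unfolding I_def by (simp add: sum.cartesian_product case_prod_beta)
    also have "\<dots> = (\<Sum>s\<in>I. sV (c (fst s) * W.pairing (?s s) w) (\<Sum>r\<in>R. sV (e (s, r)) (?t r)))"
      using t_eq by (intro sum.cong) auto
    also have "\<dots> = (\<Sum>r\<in>R. sV (?z r) (?t r))"
      by (simp add: V.scale_sum_right V.scale_sum_left sum.swap[of _ R])
    also have "\<dots> = (\<Sum>v\<in>?t ` R. sV (?z (the_inv_into R ?t v)) v)"
      by (simp add: sum.reindex[OF injR] the_inv_into_f_f[OF injR])
    finally have "?z (the_inv_into R ?t (?t r)) = 0"
      using V.independentD[of "?t ` R" "?t ` R" "\<lambda>v. ?z (the_inv_into R ?t v)" "?t r"]
        B(2) tR fR r by auto
    then show ?thesis using r by (simp add: the_inv_into_f_f[OF injR] mult_ac)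
  qed
  have s_eq: "?s s = (\<Sum>r\<in>I - R. sW (dual_pattern c R e (s, r)) (?s r))" if s: "s \<in> I" for s
  proof (cases "s \<in> R")
    case True
    show ?thesis
    \<comment> \<open>The relation only involves the pairings of the entries of \<open>S\<close>
      with \<open>w\<close>; as \<open>w\<close> is arbitrary, nondegeneracy turns scalar identities
      into one between vectors.\<close>
    proof (rule W.pairing_eqI)
      fix w
      have "(\<Sum>r\<in>R. c (fst r) * e (r, s) * W.pairing (?s r) w)
          = (\<Sum>r\<in>R. if r = s then c (fst s) * W.pairing (?s s) w else 0)"
        using RI s True by (intro sum.cong) (auto simp: e_def)
      then have "(\<Sum>r\<in>R. c (fst r) * e (r, s) * W.pairing (?s r) w) = c (fst s) * W.pairing (?s s) w"
        using True fR by simp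
      then have "0 = c (fst s) * W.pairing (?s s) w
          + (\<Sum>r\<in>I - R. c (fst r) * e (r, s) * W.pairing (?s r) w)"
        using coeff[OF True, of w]
          sum.subset_diff[OF RI fI, of "\<lambda>r. c (fst r) * e (r, s) * W.pairing (?s r) w"]
        by (simp add: add.commute)
      then have "W.pairing (?s s) w
          = - (\<Sum>r\<in>I - R. c (fst r) * e (r, s) * W.pairing (?s r) w) / c (fst s)"
        using c[of "fst s"] by (simp add: field_simps eq_neg_iff_add_eq_0)
      also have "\<dots> = (\<Sum>r\<in>I - R. dual_pattern c R e (s, r) * W.pairing (?s r) w)"
        using True by (simp add: dual_pattern_def sum_divide_distrib sum_negf[symmetric] mult_ac)
      finally show "W.pairing (?s s) w
          = W.pairing (\<Sum>r\<in>I - R. sW (dual_pattern c R e (s, r)) (?s r)) w"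
        by (simp add: W.pairing_sum_left W.pairing_scale_left)
    qed
  next
    case False
    have "(\<Sum>r\<in>I - R. sW (dual_pattern c R e (s, r)) (?s r)) = (\<Sum>r\<in>I - R. if r = s then ?s r else 0)"
      using False by (intro sum.cong) (auto simp: dual_pattern_def)
    then show ?thesis using False s fI by simp
  qed
  have "T i j = (\<Sum>r\<in>R. sV (e ((i, j), r)) (?t r))" if "i < k" "j < d" for i j
    using t_eq[of "(i, j)", unfolded fst_conv snd_conv] that unfolding I_def by blast
  then have "T \<in> V.pattern_tables k d R e"
    unfolding V.pattern_tables_def using T by blast
  moreover have "S i j = (\<Sum>r\<in>I - R. sW (dual_pattern c R e ((i, j), r)) (?s r))"
    if "i < k" "j < d" for i j
    using s_eq[of "(i, j)", unfolded fst_conv snd_conv] that unfolding I_def by blast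
  then have "S \<in> W.pattern_tables k d (I - R) (dual_pattern c R e)"
    unfolding W.pattern_tables_def using S by blast
  moreover have "e \<in> I \<times> I \<rightarrow>\<^sub>E UNIV" unfolding e_def by auto
  ultimately show ?thesis
    by (intro bexI[of _ R] bexI[of _ e] conjI) (simp_all add: RI)
qed

text \<open>By \<open>dual_patterns_exist\<close>, \<open>Z\<close> is covered by products of two
  pattern sets, one for each choice of \<open>R\<close> and \<open>e\<close>. Overlaps do no harm
  because the weights are nonnegative. The factor before the parenthesis counts the choices;
  \<open>bound\<close> treats a single one, giving the rowwise estimate to the space with the
  smaller set of free positions and Cauchy-Schwarz to the other.\<close>

lemma sum_related_tables_le:
  fixes a :: "(nat \<Rightarrow> 'v) \<Rightarrow> (nat \<Rightarrow> 'w) \<Rightarrow> real" and k d M :: nat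
  defines "N \<equiv> k * d"
  assumes k: "k \<ge> 4" and c: "\<And>i. c i \<noteq> 0"
    and M: "V.dim (UNIV :: 'v set) \<le> M" "W.dim (UNIV :: 'w set) \<le> M"
    and nonneg: "\<And>x y. 0 \<le> a x y"
    and supp: "\<And>x y. a x y \<noteq> 0 \<Longrightarrow> V.indep_family d x" "\<And>x y. a x y \<noteq> 0 \<Longrightarrow> W.indep_family d y"
    and Z: "Z \<subseteq> V.tables k d \<times> W.tables k d"
    and rel: "\<And>T S w. (T, S) \<in> Z \<Longrightarrow>
      (\<Sum>i<k. \<Sum>j<d. sV (c i * W.pairing (S i j) w) (T i j)) = 0"
  shows "(\<Sum>(T, S)\<in>Z. \<Prod>i<k. a (T i) (S i))
    \<le> 2 ^ N * real CARD('k) ^ (N * N) * (real k * real CARD('k) powr ((3 * real k / 4 - 1) * real d * real M)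
      * ((\<Sum>x\<in>V.tuples d. sqrt (\<Sum>y\<in>W.tuples d. (a x y)\<^sup>2) ^ k)
       + (\<Sum>y\<in>W.tuples d. sqrt (\<Sum>x\<in>V.tuples d. (a x y)\<^sup>2) ^ k)))"
proof -
  define I :: "(nat \<times> nat) set" where "I = {..<k} \<times> {..<d}"
  let ?q = "real CARD('k)"
  let ?E = "(3 * real k / 4 - 1) * real d * real M"
  let ?A = "\<Sum>x\<in>V.tuples d. sqrt (\<Sum>y\<in>W.tuples d. (a x y)\<^sup>2) ^ k"
  let ?B = "\<Sum>y\<in>W.tuples d. sqrt (\<Sum>x\<in>V.tuples d. (a x y)\<^sup>2) ^ k"
  let ?PV = "\<lambda>R e. V.pattern_tables k d R e"
  let ?PW = "\<lambda>R e. W.pattern_tables k d (I - R) (dual_pattern c R e)"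
  let ?J = "Pow I \<times> (I \<times> I \<rightarrow>\<^sub>E (UNIV :: 'k set))"
  let ?g = "\<lambda>(T, S). \<Prod>i<k. a (T i) (S i)"
  have fI: "finite I" and cI: "card I = N" unfolding I_def N_def by simp_all
  have fJ: "finite ?J" by (intro finite_cartesian_product finite_PiE) (simp_all add: fI)
  have q: "?q \<ge> 1" using card_gt_0_iff[of "UNIV::'k set"] by (simp add: Suc_le_eq)
  have A0: "?A \<ge> 0" and B0: "?B \<ge> 0"
    by (intro sum_nonneg zero_le_power real_sqrt_ge_zero zero_le_power2)+
  \<comment> \<open>The first factor comes from the equidistribution of a row, the square root from
    Cauchy-Schwarz. Replacing both dimensions by \<open>M\<close> leaves one inequality between
    exponents.\<close>
  have pow: "(?q ^ m) ^ s * sqrt ((?q ^ n) ^ t) \<le> ?q powr ?E"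
    if mn: "m \<le> M" "n \<le> M" and st: "real s + real t / 2 \<le> (3 * real k / 4 - 1) * real d" for m n s t
  proof -
    have "sqrt ((?q ^ n) ^ t) = ?q powr (real (n * t) / 2)"
      using q by (simp add: powr_half_sqrt[symmetric] powr_powr power_mult[symmetric] powr_realpow[symmetric])
    moreover have "(?q ^ m) ^ s = ?q powr (real (m * s))"
      using q by (simp add: power_mult[symmetric] powr_realpow[symmetric] powr_powr)
    ultimately have "(?q ^ m) ^ s * sqrt ((?q ^ n) ^ t) = ?q powr (real (m * s) + real (n * t) / 2)"
      by (simp add: powr_add)
    also have "\<dots> \<le> ?q powr ?E"
    proof (rule powr_mono)
      have "real (m * s) + real (n * t) / 2 \<le> real (M * s) + real (M * t) / 2"
        using mn by (intro add_mono divide_right_mono) (auto simp del: of_nat_mult)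
      also have "\<dots> = real M * (real s + real t / 2)" by (simp add: algebra_simps)
      also have "\<dots> \<le> real M * ((3 * real k / 4 - 1) * real d)" using st by (intro mult_left_mono) auto
      finally show "real (m * s) + real (n * t) / 2 \<le> ?E" by (simp add: mult_ac)
    qed (use q in simp)
    finally show ?thesis .
  qed
  \<comment> \<open>If \<open>r > d\<close>, the left side is \<open>(N + r) / 2 - d\<close>, at
    most \<open>3 * N / 4 - d\<close>. If \<open>r \<le> d\<close>, the first term is truncated to 0
    and \<open>N / 2 \<le> 3 * N / 4 - d\<close> is needed, that is \<open>4 * d \<le> N\<close>;
    this is where \<open>k \<ge> 4\<close> enters.\<close>
  have expo: "real (r - d) + real (N - r) / 2 \<le> (3 * real k / 4 - 1) * real d"
    if "2 * r \<le> N" for r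
  proof -
    have kd: "4 * real d \<le> real N" unfolding N_def using k
      by (metis mult_le_mono1 of_nat_le_iff of_nat_mult of_nat_numeral)
    have "(3 * real k / 4 - 1) * real d = 3 * real N / 4 - real d"
      unfolding N_def by (simp add: algebra_simps)
    moreover have "2 * real r \<le> real N" using that by linarith
    ultimately show ?thesis using kd that by (cases "r \<le> d") (simp_all add: of_nat_diff field_simps)
  qed
  have bound: "(\<Sum>T\<in>?PV R e. \<Sum>S\<in>?PW R e. ?g (T, S)) \<le> real k * ?q powr ?E * (?A + ?B)"
    if R: "R \<in> Pow I" for R e
  proof (cases "2 * card R \<le> N")
    case True
    have "(\<Sum>T\<in>?PV R e. \<Sum>S\<in>?PW R e. ?g (T, S))
        \<le> sqrt (card (?PW R e)) * (real k * (real CARD('v) ^ (card R - d) * ?A))"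
      unfolding prod.case
      using R k by (intro V.sum_pattern_tables_le W.finite_tuples nonneg supp(1))
        (auto simp: I_def W.pattern_tables_def)
    also have "\<dots> \<le> sqrt (real CARD('w) ^ (N - card R)) * (real k * (real CARD('v) ^ (card R - d) * ?A))"
    proof -
      have "card (?PW R e) \<le> CARD('w) ^ card (I - R)"
        by (rule W.card_pattern_tables_le) (auto simp: I_def)
      also have "card (I - R) = N - card R" using R fI cI by (simp add: card_Diff_subset finite_subset)
      finally show ?thesis using A0
        by (intro mult_right_mono real_sqrt_le_mono) (auto simp flip: of_nat_power)
    qed
    also have "\<dots> = real k * (real CARD('v) ^ (card R - d) * sqrt (real CARD('w) ^ (N - card R))) * ?A"
      by simp
    also have "\<dots> \<le> real k * (?q powr ?E) * ?A"
      unfolding V.card_carrier W.card_carrier of_nat_power using A0 expo[OF True] M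
      by (intro mult_right_mono mult_left_mono pow) auto
    also have "\<dots> \<le> real k * ?q powr ?E * (?A + ?B)" using B0 by (intro mult_left_mono) auto
    finally show ?thesis .
  next
    \<comment> \<open>Now \<open>I - R\<close> has fewer than \<open>N / 2\<close> elements, so the
      rows of \<open>S\<close> are equidistributed and Cauchy-Schwarz runs over
      \<open>T\<close>.\<close>
    case False
    have cR: "card R \<le> N" using R fI cI card_mono by blast
    have cIR: "card (I - R) = N - card R" using R fI cI by (simp add: card_Diff_subset finite_subset)
    have "(\<Sum>T\<in>?PV R e. \<Sum>S\<in>?PW R e. ?g (T, S)) = (\<Sum>S\<in>?PW R e. \<Sum>T\<in>?PV R e. ?g (T, S))"
      by (rule sum.swap)
    also have "\<dots> \<le> sqrt (card (?PV R e)) * (real k * (real CARD('w) ^ (card (I - R) - d) * ?B))"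
      unfolding prod.case
      using R k by (intro W.sum_pattern_tables_le V.finite_tuples nonneg supp(2))
        (auto simp: I_def V.pattern_tables_def)
    also have "\<dots> \<le> sqrt (real CARD('v) ^ (N - (N - card R))) * (real k * (real CARD('w) ^ (card (I - R) - d) * ?B))"
    proof -
      have "card (?PV R e) \<le> CARD('v) ^ card R"
        using R by (intro V.card_pattern_tables_le) (auto simp: I_def)
      \<comment> \<open>Written this way, the exponent has the form \<open>N - r\<close> with
        \<open>r = N - card R\<close>, to which \<open>expo\<close> applies.\<close>
      also have "card R = N - (N - card R)" using cR by simp
      finally show ?thesis using B0
        by (intro mult_right_mono real_sqrt_le_mono) (auto simp flip: of_nat_power)
    qed
    also have "\<dots> = real k * (real CARD('w) ^ ((N - card R) - d) * sqrt (real CARD('v) ^ (N - (N - card R)))) * ?B"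
      by (simp add: cIR)
    also have "\<dots> \<le> real k * (?q powr ?E) * ?B"
    proof -
      have "2 * (N - card R) \<le> N" using False cR by linarith
      then show ?thesis
        unfolding V.card_carrier W.card_carrier of_nat_power using B0 M
        by (intro mult_right_mono mult_left_mono pow expo) auto
    qed
    also have "\<dots> \<le> real k * ?q powr ?E * (?A + ?B)" using A0 by (intro mult_left_mono) auto
    finally show ?thesis .
  qed
  have g0: "0 \<le> ?g z" for z using nonneg by (auto simp: case_prod_beta intro!: prod_nonneg)
  \<comment> \<open>Pairs are tagged with their pattern, so the cover becomes a disjoint
    union.\<close>
  let ?U = "SIGMA j:?J. ?PV (fst j) (snd j) \<times> ?PW (fst j) (snd j)"
  have fZ: "finite Z"
    by (rule finite_subset[OF Z]) (intro finite_cartesian_product V.finite_tables W.finite_tables)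
  have fU: "finite ?U"
    by (intro finite_SigmaI[OF fJ] finite_cartesian_product V.finite_pattern_tables W.finite_pattern_tables)
  have "sum ?g Z \<le> (\<Sum>u\<in>?U. ?g (snd u))"
  proof (rule sum_le_included[OF fZ fU, of _ snd])
    show "\<forall>z\<in>Z. \<exists>u\<in>?U. snd u = z \<and> ?g z \<le> ?g (snd u)"
    proof
      fix z assume z: "z \<in> Z"
      obtain T S where TS: "z = (T, S)" by (cases z)
      have mem: "T \<in> V.tables k d" "S \<in> W.tables k d"
        using subsetD[OF Z z] unfolding TS mem_Sigma_iff by (rule conjunct1, rule conjunct2)
      have "\<exists>R\<in>Pow I. \<exists>e\<in>I \<times> I \<rightarrow>\<^sub>E UNIV. T \<in> ?PV R e \<and> S \<in> ?PW R e"
        by (rule dual_patterns_exist[OF mem c rel[OF z[unfolded TS]], folded I_def])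
      then obtain R where R: "R \<in> Pow I"
        and ex: "\<exists>e\<in>I \<times> I \<rightarrow>\<^sub>E UNIV. T \<in> ?PV R e \<and> S \<in> ?PW R e" by (rule bexE)
      from ex obtain e where e: "e \<in> I \<times> I \<rightarrow>\<^sub>E UNIV" "T \<in> ?PV R e \<and> S \<in> ?PW R e" by (rule bexE)
      have "((R, e), z) \<in> ?U" unfolding TS by (intro SigmaI; simp only: fst_conv snd_conv R e)
      then show "\<exists>u\<in>?U. snd u = z \<and> ?g z \<le> ?g (snd u)" 
        by (intro bexI[of _ "((R, e), z)"] conjI) (simp_all only: snd_conv order_refl)
    qed
  qed (intro ballI g0)
  also have "\<dots> = (\<Sum>j\<in>?J. \<Sum>z\<in>?PV (fst j) (snd j) \<times> ?PW (fst j) (snd j). ?g z)"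
  proof -
    have "\<forall>j\<in>?J. finite (?PV (fst j) (snd j) \<times> ?PW (fst j) (snd j))"
      by (intro ballI finite_cartesian_product V.finite_pattern_tables W.finite_pattern_tables)
    from sum.Sigma[OF fJ this, of "\<lambda>_. ?g"] show ?thesis by (simp only: case_prod_unfold)
  qed
  also have "\<dots> = (\<Sum>j\<in>?J. \<Sum>T\<in>?PV (fst j) (snd j). \<Sum>S\<in>?PW (fst j) (snd j). ?g (T, S))"
    by (simp add: sum.cartesian_product)
  also have "\<dots> \<le> (\<Sum>j\<in>?J. real k * ?q powr ?E * (?A + ?B))"
  proof (rule sum_mono)
    fix j assume "j \<in> ?J"
    then show "(\<Sum>T\<in>?PV (fst j) (snd j). \<Sum>S\<in>?PW (fst j) (snd j). ?g (T, S))
        \<le> real k * ?q powr ?E * (?A + ?B)"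
      by (intro bound) (simp add: mem_Times_iff)
  qed
  also have "\<dots> = real (card ?J) * (real k * ?q powr ?E * (?A + ?B))" by simp
  also have "card ?J = 2 ^ N * CARD('k) ^ (N * N)"
    using fI cI by (simp add: card_cartesian_product card_Pow card_PiE)
  finally show ?thesis by simp
qed

end

section \<open>Maps of rank d as tensors\<close>

context finite_field_space
begin

definition perp :: "'v set \<Rightarrow> 'v set"
  where "perp S = {v. \<forall>w\<in>S. pairing v w = 0}"

text \<open>A basis of \<open>S\<close> is completed to one of the whole space by \<open>d\<close>
  vectors. An element of the annihilator is determined by its pairings with these, since those with
  \<open>S\<close> are 0.\<close>

lemma card_perp_le:
  assumes "subspace S" "dim S + d = dim (UNIV :: 'v set)"
  shows "card (perp S) \<le> CARD('k) ^ d"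
proof -
  obtain B1 where B1: "B1 \<subseteq> S" "independent B1" "S \<subseteq> span B1" "card B1 = dim S"
    using basis_exists[of S] by metis
  obtain B where B: "B1 \<subseteq> B" "B \<subseteq> UNIV" "independent B" "UNIV \<subseteq> span B"
    by (rule maximal_independent_subset_extend[OF subset_UNIV B1(2)])
  have fB: "finite B" using B(3) finiteI_independent by simp
  have "card B = dim (UNIV :: 'v set)" by (rule basis_card_eq_dim[OF B(2,4,3)])
  then have cC: "card (B - B1) = d"
    using card_Diff_subset[OF finite_subset[OF B(1) fB] B(1)] B1(4) assms(2) by simp
  let ?f = "\<lambda>v. restrict (pairing v) (B - B1)"
  have "card (perp S) \<le> card ((B - B1) \<rightarrow>\<^sub>E (UNIV :: 'k set))"
  proof (rule card_inj_on_le)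
    show "inj_on ?f (perp S)"
    proof (rule inj_onI)
      fix v v' assume v: "v \<in> perp S" "v' \<in> perp S" and eq: "?f v = ?f v'"
      have sub: "subspace {w. pairing v w = pairing v' w}"
        by (rule subspaceI)
          (simp_all add: pairing_add_right pairing_scale_right pairing_scale_right[of _ 0 0, simplified])
      have "b \<in> {w. pairing v w = pairing v' w}" if b: "b \<in> B" for b
      proof (cases "b \<in> B1")
        case True
        then show ?thesis using v B1(1) unfolding perp_def by (simp add: subset_iff)
      next
        case False
        have "?f v b = ?f v' b" by (simp only: eq)
        then show ?thesis using b False by simp
      qed
      then have "span B \<subseteq> {w. pairing v w = pairing v' w}" using sub by (intro span_minimal subsetI)
      then show "v = v'" using B(4) by (intro pairing_eqI) blast
    qed
    show "finite ((B - B1) \<rightarrow>\<^sub>E (UNIV :: 'k set))" using fB by (intro finite_PiE) simp_all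
  qed (intro image_subsetI PiE_I; auto)
  then show ?thesis using fB cC by (simp add: card_PiE)
qed

end

section \<open>Factorisations of rank-d maps, their images and kernels\<close>

context finite_field_space_pair
begin

text \<open>The sum of the elementary tensors of \<open>x j\<close> with the functional that
  \<open>y j\<close> represents.\<close>

definition tensor :: "nat \<Rightarrow> (nat \<Rightarrow> 'v) \<Rightarrow> (nat \<Rightarrow> 'w) \<Rightarrow> 'w \<Rightarrow> 'v"
  where "tensor d x y w = (\<Sum>j<d. sV (W.pairing (y j) w) (x j))"

definition independent_tensor :: "nat \<Rightarrow> (nat \<Rightarrow> 'v) \<Rightarrow> (nat \<Rightarrow> 'w) \<Rightarrow> bool"
  where "independent_tensor d x y \<longleftrightarrow> V.indep_family d x \<and> W.indep_family d y \<and>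
    range (tensor d x y) = V.span (x ` {..<d})"

lemma vector_spaces: "vector_space sV" "vector_space sW"
  by unfold_locales

lemma linear_maps_iff:
  "X \<in> linear_maps sW sV \<longleftrightarrow> (\<forall>v w. X (v + w) = X v + X w) \<and> (\<forall>c w. X (sW c w) = sV c (X w))"
  using vector_spaces by (simp add: linear_maps_def Vector_Spaces.linear_iff)

lemma tensor_linear: "tensor d x y \<in> linear_maps sW sV"
  unfolding linear_maps_iff tensor_def
  by (simp add: W.pairing_add_right W.pairing_scale_right V.scale_left_distrib sum.distrib V.scale_sum_right)

lemma finite_linear_maps: "finite (linear_maps sW sV)"
proof -
  have "finite (PiE (UNIV :: 'w set) (\<lambda>_. UNIV :: 'v set))"
    by (rule finite_PiE[OF W.finite_carrier V.finite_carrier])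
  then have "finite (UNIV :: ('w \<Rightarrow> 'v) set)" by (simp add: PiE_UNIV_domain)
  then show ?thesis by (rule finite_subset[OF subset_UNIV])
qed

text \<open>Take for \<open>x\<close> an enumerated basis of the image; the coordinates of
  \<open>X w\<close> in it are linear functionals of \<open>w\<close>, and \<open>y\<close> consists
  of the vectors representing them.\<close>

lemma rank_factorization:
  assumes X: "X \<in> linear_maps sW sV" and rank: "rank_of sV X = d"
  shows "\<exists>x\<in>V.tuples d. \<exists>y\<in>W.tuples d. independent_tensor d x y \<and> tensor d x y = X"
proof -
  interpret X: Vector_Spaces.linear sW sV X using X unfolding linear_maps_def by simp
  have subX: "V.subspace (range X)" by (rule X.subspace_image) simp
  obtain B where B: "B \<subseteq> range X" "V.independent B" "range X \<subseteq> V.span B" "card B = d"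
    using V.basis_exists[of "range X"] rank unfolding rank_of_def by metis
  have fB: "finite B" by (rule V.finiteI_independent[OF B(2)])
  have spanB: "V.span B = range X" by (rule V.span_subspace[OF B(1,3) subX])
  obtain h where h: "bij_betw h {..<d} B"
    using ex_bij_betw_nat_finite[OF fB] B(4) by (auto simp: atLeast0LessThan)
  define x where "x = restrict h {..<d}"
  have xh: "x j = h j" if "j < d" for j using that by (simp add: x_def)
  have x: "x \<in> V.tuples d" unfolding x_def by simp
  have xB: "x ` {..<d} = B" "inj_on x {..<d}"
    using h xh by (auto simp: bij_betw_def inj_on_def)
  have indx: "V.indep_family d x" using xB B(2) by (intro V.indep_familyI) simp_all
  let ?phi = "\<lambda>j w. V.representation B (X w) (x j)"
  have inB: "X w \<in> V.span B" for w by (simp add: spanB)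
  have "\<exists>v. \<forall>w. W.pairing v w = ?phi j w" for j
  proof (rule W.pairing_represents)
    show "?phi j (v + w) = ?phi j v + ?phi j w" for v w
      using V.representation_add[OF B(2) inB inB] by (simp add: X.add)
    show "?phi j (sW c v) = c * ?phi j v" for c v
      using V.representation_scale[OF B(2) inB] by (simp add: X.scale)
  qed
  then obtain y0 where y0: "\<And>j w. W.pairing (y0 j) w = ?phi j w" by metis
  define y where "y = restrict y0 {..<d}"
  have y: "y \<in> W.tuples d" unfolding y_def by simp
  have pair_y: "W.pairing (y j) w = ?phi j w" if "j < d" for j w using that by (simp add: y_def y0)
  have tX: "tensor d x y w = X w" for w
  proof -
    have "tensor d x y w = (\<Sum>j<d. sV (V.representation B (X w) (x j)) (x j))"
      unfolding tensor_def by (intro sum.cong) (simp_all add: pair_y)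
    also have "\<dots> = (\<Sum>b\<in>B. sV (V.representation B (X w) b) b)"
      using sum.reindex[OF xB(2), of "\<lambda>b. sV (V.representation B (X w) b) b"] xB(1) by simp
    also have "\<dots> = X w" by (rule V.sum_representation_eq[OF B(2) inB fB order_refl])
    finally show ?thesis .
  qed
  \<comment> \<open>At a preimage of \<open>x i\<close> the coordinate functionals take the values 1
    at \<open>i\<close> and 0 elsewhere, which isolates the coefficient \<open>c i\<close>.\<close>
  have "W.indep_family d y"
    unfolding W.indep_family_def
  proof (intro allI impI)
    fix c i assume c: "(\<Sum>j<d. sW (c j) (y j)) = 0" and i: "i < d"
    have xi: "x i \<in> B" using i xB(1) by blast
    then obtain w where w: "X w = x i" using B(1) by (metis imageE subsetD)
    have "0 = W.pairing (\<Sum>j<d. sW (c j) (y j)) w"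
      unfolding c using W.pairing_scale_left[of 0 0 w] by simp
    also have "\<dots> = (\<Sum>j<d. c j * ?phi j w)"
      by (simp add: W.pairing_sum_left W.pairing_scale_left pair_y)
    also have "\<dots> = (\<Sum>j<d. if j = i then c i else 0)"
      using i inj_onD[OF xB(2)] unfolding w V.representation_basis[OF B(2) xi]
      by (intro sum.cong) auto
    also have "\<dots> = c i" using i by simp
    finally show "c i = 0" by simp
  qed
  then have "independent_tensor d x y"
    unfolding independent_tensor_def using indx xB(1) spanB tX by auto
  then show ?thesis using x y tX by (intro bexI[of _ x] bexI[of _ y] conjI ext)
qed

lemma kernel_tensor:
  assumes "V.indep_family d x"
  shows "{w. tensor d x y w = 0} = {w. \<forall>j<d. W.pairing (y j) w = 0}"
proof -
  have "\<forall>j<d. W.pairing (y j) w = 0" if "tensor d x y w = 0" for w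
    using assms[unfolded V.indep_family_def, rule_format, of "\<lambda>j. W.pairing (y j) w"] that
    unfolding tensor_def by simp
  then show ?thesis by (auto simp: tensor_def)
qed

text \<open>A preimage of \<open>x i\<close> works: its image has coordinates
  \<open>W.pairing (y j) w\<close> in \<open>x\<close>, and coordinates in an independent family are
  unique.\<close>

lemma dual_family_exists:
  assumes "independent_tensor d x y" "i < d"
  shows "\<exists>w. \<forall>j<d. W.pairing (y j) w = (if j = i then 1 else 0)"
proof -
  have ind: "V.indep_family d x" using assms(1) unfolding independent_tensor_def by blast
  have "x i \<in> range (tensor d x y)"
    using assms V.span_base[of "x i" "x ` {..<d}"] unfolding independent_tensor_def by simp
  then obtain w where w: "x i = tensor d x y w" by blast
  have "(\<Sum>j<d. sV (if j = i then 1 else 0) (x j)) = (\<Sum>j<d. if j = i then x j else 0)"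
    by (intro sum.cong) auto
  then have "(\<Sum>j<d. sV (if j = i then 1 else 0) (x j)) = tensor d x y w"
    using assms(2) w by simp
  then have "W.pairing (y j) w = (if j = i then 1 else 0)" if "j < d" for j
    using V.indep_family_unique[OF ind, of "\<lambda>j. if j = i then 1 else 0" "\<lambda>j. W.pairing (y j) w" j] that
    unfolding tensor_def by simp
  then show ?thesis by blast
qed

text \<open>Rank-nullity by counting: the fibres over the image are translates of the kernel, so the
  size of \<open>W\<close> is the product of the sizes of image and kernel, and powers of
  \<open>CARD('k) > 1\<close> have unique exponents.\<close>

lemma dim_kernel:
  assumes X: "X \<in> linear_maps sW sV"
  shows "W.subspace {w. X w = 0}" "W.dim {w. X w = 0} + V.dim (range X) = W.dim (UNIV :: 'w set)"
proof -
  interpret X: Vector_Spaces.linear sW sV X using X unfolding linear_maps_def by simp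
  let ?K = "{w. X w = 0}"
  show K: "W.subspace ?K" by (rule X.subspace_kernel)
  have subX: "V.subspace (range X)" by (rule X.subspace_image) simp
  have fibre: "card {w. X w = v} = card ?K" if v: "v \<in> range X" for v
  proof -
    obtain w0 where w0: "v = X w0" using v by blast
    have "bij_betw (\<lambda>w. w + w0) ?K {w. X w = v}"
      by (rule bij_betw_byWitness[of _ "\<lambda>w. w - w0"]) (auto simp: X.add X.diff w0)
    then show ?thesis by (rule bij_betw_same_card[symmetric])
  qed
  have "CARD('w) = (\<Sum>w\<in>(UNIV :: 'w set). 1)" by simp
  also have "\<dots> = (\<Sum>v\<in>range X. \<Sum>w | w \<in> UNIV \<and> X w = v. 1)"
    by (rule sum.image_gen[OF W.finite_carrier])
  also have "\<dots> = (\<Sum>v\<in>range X. card ?K)" using fibre by (intro sum.cong) simp_all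
  also have "\<dots> = card (range X) * card ?K" by simp
  finally have "CARD('k) ^ W.dim (UNIV :: 'w set) = CARD('k) ^ (W.dim ?K + V.dim (range X))"
    unfolding W.card_carrier V.card_subspace[OF subX] W.card_subspace[OF K] power_add by simp
  moreover have "card {0, 1 :: 'k} \<le> CARD('k)" by (rule card_mono) simp_all
  then have "CARD('k) > 1" by simp
  ultimately show "W.dim ?K + V.dim (range X) = W.dim (UNIV :: 'w set)" by simp
qed

text \<open>For fixed independent \<open>x\<close> the map determines \<open>y\<close>, as the
  pairings with \<open>y j\<close> are its coordinates. Each map with the given image is thus
  counted at most once.\<close>

lemma sum_independent_tensor_image_le:
  fixes F :: "('w \<Rightarrow> 'v) \<Rightarrow> real"
  assumes nonneg: "\<And>X. 0 \<le> F X"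
  shows "(\<Sum>y | y \<in> W.tuples d \<and> independent_tensor d x y. F (tensor d x y))
    \<le> (\<Sum>X | X \<in> linear_maps sW sV \<and> range X = V.span (x ` {..<d}). F X)"
proof -
  let ?Y = "{y. y \<in> W.tuples d \<and> independent_tensor d x y}"
  have inj: "inj_on (tensor d x) ?Y"
  proof (rule inj_onI)
    fix y y' assume y: "y \<in> ?Y" "y' \<in> ?Y" and eq: "tensor d x y = tensor d x y'"
    have ind: "V.indep_family d x" using y(1) unfolding independent_tensor_def by blast
    have "y j = y' j" if "j < d" for j
    proof (rule W.pairing_eqI)
      show "W.pairing (y j) w = W.pairing (y' j) w" for w
        using V.indep_family_unique[OF ind, of "\<lambda>j. W.pairing (y j) w" "\<lambda>j. W.pairing (y' j) w" j]
          fun_cong[OF eq, of w] that unfolding tensor_def by simp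
    qed
    moreover have "y \<in> W.tuples d" "y' \<in> W.tuples d" using y by simp_all
    ultimately show "y = y'" by (intro PiE_ext[of y "{..<d}" "\<lambda>_. UNIV" y']) simp_all
  qed
  have "(\<Sum>y\<in>?Y. F (tensor d x y)) = (\<Sum>X\<in>tensor d x ` ?Y. F X)"
    by (simp add: sum.reindex[OF inj])
  also have "\<dots> \<le> (\<Sum>X | X \<in> linear_maps sW sV \<and> range X = V.span (x ` {..<d}). F X)"
    using nonneg finite_linear_maps
    by (intro sum_mono2) (simp_all add: image_subset_iff tensor_linear independent_tensor_def)
  finally show ?thesis .
qed

text \<open>For fixed \<open>y\<close> the map determines \<open>x\<close>, by evaluation at the
  vectors dual to \<open>y\<close>; its kernel depends on \<open>y\<close> alone.\<close>

lemma sum_independent_tensor_kernel_le: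
  fixes F :: "('w \<Rightarrow> 'v) \<Rightarrow> real"
  assumes nonneg: "\<And>X. 0 \<le> F X"
  shows "(\<Sum>x | x \<in> V.tuples d \<and> independent_tensor d x y. F (tensor d x y))
    \<le> (\<Sum>X | X \<in> linear_maps sW sV \<and> {w. X w = 0} = {w. \<forall>j<d. W.pairing (y j) w = 0}. F X)"
proof -
  let ?Y = "{x. x \<in> V.tuples d \<and> independent_tensor d x y}"
  have inj: "inj_on (\<lambda>x. tensor d x y) ?Y"
  proof (rule inj_onI)
    fix x x' assume x: "x \<in> ?Y" "x' \<in> ?Y" and eq: "tensor d x y = tensor d x' y"
    have "x i = x' i" if i: "i < d" for i
    proof -
      have "independent_tensor d x y" using x by simp
      from dual_family_exists[OF this i] obtain w
        where w: "\<forall>j<d. W.pairing (y j) w = (if j = i then 1 else 0)" by blast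
      have t: "tensor d z y w = z i" for z
      proof -
        have "tensor d z y w = (\<Sum>j<d. if j = i then z j else 0)"
          unfolding tensor_def using w by (intro sum.cong) simp_all
        then show ?thesis using i by simp
      qed
      show ?thesis using t[of x] t[of x'] eq by simp
    qed
    moreover have "x \<in> V.tuples d" "x' \<in> V.tuples d" using x by simp_all
    ultimately show "x = x'" by (intro PiE_ext[of x "{..<d}" "\<lambda>_. UNIV" x']) simp_all
  qed
  have "(\<Sum>x\<in>?Y. F (tensor d x y)) = (\<Sum>X\<in>(\<lambda>x. tensor d x y) ` ?Y. F X)"
    by (simp add: sum.reindex[OF inj])
  also have "\<dots> \<le> (\<Sum>X | X \<in> linear_maps sW sV \<and> {w. X w = 0} = {w. \<forall>j<d. W.pairing (y j) w = 0}. F X)"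
    using nonneg finite_linear_maps kernel_tensor
    by (intro sum_mono2) (simp_all add: image_subset_iff tensor_linear independent_tensor_def)
  finally show ?thesis .
qed

text \<open>A tuple spanning \<open>S\<close> has its \<open>d\<close> entries in \<open>S\<close>,
  a set of \<open>CARD('k) ^ d\<close> elements, so each \<open>S\<close> arises at most
  \<open>CARD('k) ^ (d * d)\<close> times.\<close>

lemma sum_span_le:
  fixes N :: "'v set \<Rightarrow> real"
  assumes nonneg: "\<And>S. 0 \<le> N S"
  shows "(\<Sum>x | x \<in> V.tuples d \<and> V.indep_family d x. N (V.span (x ` {..<d})))
    \<le> real CARD('k) ^ (d * d) * (\<Sum>S | V.subspace S \<and> V.dim S = d. N S)"
proof -
  let ?X = "{x. x \<in> V.tuples d \<and> V.indep_family d x}" and ?S = "{S. V.subspace S \<and> V.dim S = d}"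
  let ?f = "\<lambda>x. V.span (x ` {..<d})"
  have fX: "finite ?X" by (rule finite_subset[OF _ V.finite_tuples[of d]]) blast
  have "finite (UNIV :: 'v set set)" using V.finite_carrier by (simp add: Finite_Set.finite_set)
  then have fS: "finite ?S" by (rule finite_subset[OF subset_UNIV])
  have img: "?f ` ?X \<subseteq> ?S"
    using V.indep_family_dim_span[unfolded V.dim_span]
    by (intro image_subsetI) simp
  have card: "card {x \<in> ?X. ?f x = S} \<le> CARD('k) ^ (d * d)" if S: "S \<in> ?S" for S
  proof -
    have fin: "finite S" using V.finite_carrier by (rule finite_subset[OF subset_UNIV])
    have "card {x \<in> ?X. ?f x = S} \<le> card ({..<d} \<rightarrow>\<^sub>E S)"
    proof (rule card_mono)
      show "finite ({..<d} \<rightarrow>\<^sub>E S)" using fin by (intro finite_PiE) simp_all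
      show "{x \<in> ?X. ?f x = S} \<subseteq> {..<d} \<rightarrow>\<^sub>E S"
      proof
        fix x assume x: "x \<in> {x \<in> ?X. ?f x = S}"
        show "x \<in> {..<d} \<rightarrow>\<^sub>E S"
        proof (rule PiE_I)
          show "x j \<in> S" if "j \<in> {..<d}" for j
            using x V.span_base[of "x j" "x ` {..<d}"] that by simp
          show "x j = undefined" if "j \<notin> {..<d}" for j
            using x that by (simp add: PiE_iff extensional_def)
        qed
      qed
    qed
    also have "\<dots> = CARD('k) ^ (d * d)"
      using S V.card_subspace[of S] by (simp add: card_PiE power_mult)
    finally show ?thesis .
  qed
  have "(\<Sum>x\<in>?X. N (?f x)) = (\<Sum>S\<in>?S. \<Sum>x\<in>{x \<in> ?X. ?f x = S}. N (?f x))"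
    by (rule sum.group[OF fX fS img, symmetric])
  also have "\<dots> = (\<Sum>S\<in>?S. real (card {x \<in> ?X. ?f x = S}) * N S)"
    by (intro sum.cong) simp_all
  also have "\<dots> \<le> (\<Sum>S\<in>?S. real CARD('k) ^ (d * d) * N S)"
    using card nonneg by (intro sum_mono mult_right_mono) (simp_all flip: of_nat_power)
  finally show ?thesis by (simp add: sum_distrib_left)
qed

text \<open>The dual of \<open>sum_span_le\<close>: if \<open>S\<close> is the common kernel of the
  functionals of \<open>y\<close>, all entries of \<open>y\<close> lie in \<open>W.perp S\<close>,
  which has at most \<open>CARD('k) ^ d\<close> elements.\<close>

lemma sum_kernel_le:
  fixes N :: "'w set \<Rightarrow> real"
  assumes nonneg: "\<And>S. 0 \<le> N S"
  shows "(\<Sum>y | y \<in> W.tuples d \<and> (\<exists>x. independent_tensor d x y). N {w. \<forall>j<d. W.pairing (y j) w = 0})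
    \<le> real CARD('k) ^ (d * d)
      * (\<Sum>S | W.subspace S \<and> W.dim S + d = W.dim (UNIV :: 'w set). N S)"
proof -
  let ?X = "{y. y \<in> W.tuples d \<and> (\<exists>x. independent_tensor d x y)}"
    and ?S = "{S. W.subspace S \<and> W.dim S + d = W.dim (UNIV :: 'w set)}"
  let ?f = "\<lambda>y. {w. \<forall>j<d. W.pairing (y j) w = 0}"
  have fX: "finite ?X" by (rule finite_subset[OF _ W.finite_tuples[of d]]) blast
  have "finite (UNIV :: 'w set set)" using W.finite_carrier by (simp add: Finite_Set.finite_set)
  then have fS: "finite ?S" by (rule finite_subset[OF subset_UNIV])
  have img: "?f ` ?X \<subseteq> ?S"
  proof (rule image_subsetI)
    fix y assume "y \<in> ?X"
    then obtain x where x: "independent_tensor d x y" by blast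
    then have ind: "V.indep_family d x" and rng: "range (tensor d x y) = V.span (x ` {..<d})"
      unfolding independent_tensor_def by simp_all
    show "?f y \<in> ?S"
      using dim_kernel[OF tensor_linear[of d x y]] V.indep_family_dim_span[OF ind]
      unfolding rng kernel_tensor[OF ind] by simp
  qed
  have card: "card {y \<in> ?X. ?f y = S} \<le> CARD('k) ^ (d * d)" if S: "S \<in> ?S" for S
  proof -
    have fin: "finite (W.perp S)" using W.finite_carrier by (rule finite_subset[OF subset_UNIV])
    have "card {y \<in> ?X. ?f y = S} \<le> card ({..<d} \<rightarrow>\<^sub>E W.perp S)"
    proof (rule card_mono)
      show "finite ({..<d} \<rightarrow>\<^sub>E W.perp S)" using fin by (intro finite_PiE) simp_all
      show "{y \<in> ?X. ?f y = S} \<subseteq> {..<d} \<rightarrow>\<^sub>E W.perp S"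
      proof
        fix y assume y: "y \<in> {y \<in> ?X. ?f y = S}"
        show "y \<in> {..<d} \<rightarrow>\<^sub>E W.perp S"
        proof (rule PiE_I)
          have "S = ?f y" using y by simp
          then show "y j \<in> W.perp S" if "j \<in> {..<d}" for j
            using that unfolding W.perp_def by simp
          show "y j = undefined" if "j \<notin> {..<d}" for j
            using y that by (simp add: PiE_iff extensional_def)
        qed
      qed
    qed
    also have "\<dots> = card (W.perp S) ^ d" by (simp add: card_PiE)
    also have "\<dots> \<le> (CARD('k) ^ d) ^ d"
      using S W.card_perp_le[of S d] by (intro power_mono) simp_all
    finally show ?thesis by (simp add: power_mult)
  qed
  have "(\<Sum>y\<in>?X. N (?f y)) = (\<Sum>S\<in>?S. \<Sum>y\<in>{y \<in> ?X. ?f y = S}. N (?f y))"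
    by (rule sum.group[OF fX fS img, symmetric])
  also have "\<dots> = (\<Sum>S\<in>?S. real (card {y \<in> ?X. ?f y = S}) * N S)"
    by (intro sum.cong) simp_all
  also have "\<dots> \<le> (\<Sum>S\<in>?S. real CARD('k) ^ (d * d) * N S)"
    using card nonneg by (intro sum_mono mult_right_mono) (simp_all flip: of_nat_power)
  finally show ?thesis by (simp add: sum_distrib_left)
qed

end

section \<open>Characters and moments\<close>

text \<open>Multiplication by a nonzero \<open>x\<close> permutes the nonzero elements and hence
  preserves their product, which can be cancelled.\<close>

lemma finite_field_power_card:
  fixes x :: "'k::{field,finite}"
  shows "x ^ CARD('k) = x"
proof (cases "x = 0")
  case True
  have "CARD('k) > 0" by (simp add: card_gt_0_iff)
  then show ?thesis using True by (simp add: power_0_left)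
next
  case False
  let ?U = "UNIV - {0::'k}"
  have "(\<Prod>y\<in>?U. x * y) = \<Prod>?U"
    by (rule prod.reindex_bij_witness[of _ "\<lambda>y. y / x" "\<lambda>y. x * y"]) (simp_all add: False)
  then have eq: "x ^ card ?U * \<Prod>?U = 1 * \<Prod>?U" unfolding prod.distrib prod_constant by (simp only: mult_1_left)
  have "\<Prod>?U \<noteq> 0" by (simp only: prod_zero_iff finite) blast
  then have "x ^ card ?U = 1" using eq by (simp only: mult_cancel_right simp_thms)
  moreover have "CARD('k) = Suc (card ?U)" by (rule card.remove[OF finite UNIV_I])
  ultimately show ?thesis by (simp only: power_Suc mult_1_right)
qed

section \<open>The trace to the prime field and the additive character\<close>

locale finite_field_characters =
  fixes p s :: nat and field_type :: "'k::{field,finite} itself"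
  assumes prime_p: "prime p" and card_field: "CARD('k) = p ^ s"
begin

text \<open>Shifting by 1 permutes the field, so the sum of all elements does not change when
  \<open>CARD('k)\<close> ones are added to it.\<close>

lemma CHAR_field: "CHAR('k) = p"
proof -
  have "(\<Sum>x\<in>(UNIV::'k set). x + 1) = \<Sum>UNIV"
    by (rule sum.reindex_bij_witness[of _ "\<lambda>x. x - 1" "\<lambda>x. x + 1"]) auto
  then have "of_nat (p ^ s) = (0::'k)" by (simp add: sum.distrib card_field)
  then have "of_nat p = (0::'k)" by simp
  then have "CHAR('k) dvd p" by (simp add: of_nat_eq_0_iff_char_dvd)
  moreover have "CHAR('k) \<noteq> 1" using of_nat_CHAR[where 'a = 'k] by (intro notI) simp
  ultimately show ?thesis using prime_p prime_nat_iff by blast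
qed

lemma s_pos: "s > 0"
proof (rule ccontr)
  assume "\<not> s > 0"
  then have "CARD('k) = 1" using card_field by simp
  then have "card {0, 1 :: 'k} \<le> 1" by (metis card_mono finite subset_UNIV)
  then show False by simp
qed

abbreviation tr :: "'k \<Rightarrow> 'k" where "tr \<equiv> field_trace p s"

lemma tr_add: "tr (x + y) = tr x + tr y"
  unfolding field_trace_def sum.distrib[symmetric]
  by (intro sum.cong refl freshmans_dream') (simp_all add: CHAR_field prime_p)

text \<open>Frobenius permutes the summands of the trace cyclically, because
  \<open>x ^ (p ^ s) = x\<close>.\<close>

lemma tr_power: "tr x ^ p = tr x"
proof -
  obtain r where s: "s = Suc r" using s_pos gr0_conv_Suc by blast
  have "tr x ^ p = (\<Sum>i<s. (x ^ (p ^ i)) ^ p)"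
    unfolding field_trace_def by (rule freshmans_dream_sum) (simp_all add: CHAR_field prime_p)
  also have "\<dots> = (\<Sum>i<s. x ^ (p ^ Suc i))" by (simp add: power_mult[symmetric] mult.commute)
  also have "\<dots> = (\<Sum>i<r. x ^ (p ^ Suc i)) + x ^ CARD('k)" by (simp add: s card_field)
  also have "\<dots> = tr x"
    unfolding field_trace_def s sum.lessThan_Suc_shift by (simp add: finite_field_power_card)
  finally show ?thesis .
qed

text \<open>The multiples of 1 provide \<open>p\<close> distinct roots of \<open>t ^ p - t\<close>,
  and its degree allows no more.\<close>

lemma prime_field_eq_roots: "range of_nat = {t :: 'k. t ^ p = t}"
proof -
  let ?P = "monom 1 p - monom 1 1 :: 'k poly"
  have p1: "p > 1" using prime_p prime_gt_1_nat by blast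
  have P: "{t. poly ?P t = 0} = {t :: 'k. t ^ p = t}" by (simp add: poly_monom)
  have "poly.coeff ?P p = 1" using p1 by simp
  then have P0: "?P \<noteq> 0" by (metis coeff_0 zero_neq_one)
  have "degree ?P \<le> p" by (rule degree_diff_le) (use p1 in \<open>auto intro: order_trans[OF degree_monom_le]\<close>)
  then have le: "card {t :: 'k. t ^ p = t} \<le> p" using card_poly_roots_bound[OF P0] P by simp
  have inj: "inj_on (of_nat :: nat \<Rightarrow> 'k) {..<p}"
  proof (rule linorder_inj_onI)
    fix a b :: nat assume ab: "a < b" "a \<in> {..<p}" "b \<in> {..<p}"
    show "of_nat a \<noteq> (of_nat b :: 'k)"
    proof
      assume "of_nat a = (of_nat b :: 'k)"
      then have "of_nat (b - a) = (0 :: 'k)" using ab by (simp add: of_nat_diff)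
      then have "p dvd b - a" by (simp add: of_nat_eq_0_iff_char_dvd CHAR_field)
      then show False using ab by (auto dest: dvd_imp_le)
    qed
  qed auto
  have frob: "(of_nat a :: 'k) ^ p = of_nat a" for a
    by (induction a) (use p1 in \<open>simp_all add: freshmans_dream CHAR_field prime_p\<close>)
  have "of_nat ` {..<p} = {t :: 'k. t ^ p = t}"
    using le frob by (intro card_seteq) (auto simp: card_image[OF inj])
  then have "{t :: 'k. t ^ p = t} \<subseteq> range of_nat" by blast
  moreover have "range of_nat \<subseteq> {t :: 'k. t ^ p = t}" using frob by auto
  ultimately show ?thesis by (rule subset_antisym[rotated])
qed

lemma of_nat_prime_field_rep: "of_nat (prime_field_rep (tr x)) = tr x"
proof -
  have "tr x \<in> range of_nat" unfolding prime_field_eq_roots using tr_power by simp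
  then obtain j where "of_nat j = tr x" by (metis imageE)
  then show ?thesis unfolding prime_field_rep_def by (rule LeastI)
qed

text \<open>The trace is a nonzero polynomial of degree at most \<open>p ^ (s - 1)\<close>, too
  small to vanish on all \<open>p ^ s\<close> elements.\<close>

lemma tr_nonzero: "\<exists>x. tr x \<noteq> 0"
proof (rule ccontr)
  assume *: "\<nexists>x. tr x \<noteq> 0"
  obtain r where s: "s = Suc r" using s_pos gr0_conv_Suc by blast
  let ?P = "\<Sum>i<s. monom 1 (p ^ i) :: 'k poly"
  have p1: "p > 1" using prime_p prime_gt_1_nat by blast
  \<comment> \<open>Only \<open>i = 0\<close> gives \<open>p ^ i = 1\<close>, so the coefficient of
    the linear term certifies that the polynomial is nonzero.\<close>
  have "poly.coeff ?P 1 = (\<Sum>i<s. if i = 0 then 1 else 0)"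
    unfolding coeff_sum using p1 by (intro sum.cong) auto
  then have "poly.coeff ?P 1 = 1" using s_pos by simp
  then have P0: "?P \<noteq> 0" by (metis coeff_0 zero_neq_one)
  have "degree ?P \<le> p ^ r"
    using p1 by (intro degree_sum_le order_trans[OF degree_monom_le]) (auto simp: s)
  moreover have "{x. poly ?P x = 0} = UNIV"
    using * by (simp add: poly_sum poly_monom field_trace_def)
  ultimately have "p ^ s \<le> p ^ r" using card_poly_roots_bound[OF P0] card_field by simp
  then show False using p1 s by simp
qed

definition chi :: "'k \<Rightarrow> complex"
  where "chi x = exp (2 * of_real pi * \<i> / of_nat p) ^ prime_field_rep (tr x)"

text \<open>Any exponent representing the trace will do: two of them differ by a multiple of
  \<open>p\<close>, and \<open>p\<close>-th powers of the root of unity are 1. This frees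
  \<open>chi\<close> from the least representative and makes it additive.\<close>

lemma chi_eq:
  assumes "of_nat a = tr x"
  shows "chi x = exp (2 * of_real pi * \<i> / of_nat p) ^ a"
proof -
  let ?w = "exp (2 * of_real pi * \<i> / of_nat p)"
  have p0: "p \<noteq> 0" using prime_p by auto
  have w: "?w ^ j = 1" if "p dvd j" for j
  proof -
    obtain l where j: "j = p * l" using \<open>p dvd j\<close> by auto
    have "?w ^ p = 1" using complex_root_unity[of p 1] p0 by simp
    then show ?thesis by (simp add: j power_mult)
  qed
  have eq: "?w ^ a = ?w ^ b" if "a \<le> b" "of_nat a = (of_nat b :: 'k)" for a b
  proof -
    have "of_nat (b - a) = (0 :: 'k)" using that by (simp add: of_nat_diff)
    then have "p dvd b - a" by (simp add: of_nat_eq_0_iff_char_dvd CHAR_field)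
    then show ?thesis using w[of "b - a"] that(1) by (metis le_add_diff_inverse mult.right_neutral power_add)
  qed
  have "of_nat (prime_field_rep (tr x)) = (of_nat a :: 'k)" using assms of_nat_prime_field_rep by simp
  then show ?thesis unfolding chi_def using eq by (metis nle_le)
qed

lemma chi_add: "chi (x + y) = chi x * chi y"
proof -
  have "of_nat (prime_field_rep (tr x) + prime_field_rep (tr y)) = tr (x + y)"
    by (simp add: of_nat_prime_field_rep tr_add)
  from chi_eq[OF this] show ?thesis by (simp add: chi_def power_add)
qed

lemma chi_zero: "chi 0 = 1"
proof -
  have "tr 0 = 0" using prime_gt_0_nat[OF prime_p] by (simp add: field_trace_def power_0_left)
  then show ?thesis using chi_eq[of 0 0] by simp
qed

lemma norm_chi: "cmod (chi x) = 1"
  by (simp add: chi_def norm_power)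

lemma chi_minus: "chi (- x) = cnj (chi x)"
proof -
  have "chi x * chi (- x) = 1" using chi_add[of x "- x"] chi_zero by simp
  moreover have "chi x * cnj (chi x) = 1" using complex_norm_square[of "chi x"] by (simp add: norm_chi)
  ultimately show ?thesis by (metis mult_cancel_left mult_zero_left zero_neq_one)
qed

lemma chi_sum: "chi (\<Sum>i\<in>I. x i) = (\<Prod>i\<in>I. chi (x i))"
  by (induction I rule: infinite_finite_induct) (auto simp: chi_zero chi_add)

lemma chi_nontrivial: "\<exists>x. chi x \<noteq> 1"
proof -
  obtain x where x: "tr x \<noteq> 0" using tr_nonzero by blast
  let ?j = "prime_field_rep (tr x)"
  have "\<not> p dvd ?j"
    using x of_nat_prime_field_rep[of x] of_nat_eq_0_iff_char_dvd[where 'a = 'k, of ?j] by (simp add: CHAR_field)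
  moreover have "1 \<le> p" using prime_p prime_ge_1_nat by blast
  moreover have "exp (2 * of_real pi * \<i> * of_nat ?j / of_nat p) = chi x"
    unfolding chi_def exp_of_nat_mult[symmetric] by (simp add: field_simps)
  ultimately show ?thesis using complex_root_unity_eq_1[of p ?j] by metis
qed

end

section \<open>Orthogonality of characters and moments of character sums\<close>

locale matrix_fourier =
  finite_field_space_pair sV BV sW BW + finite_field_characters p s "TYPE('k)"
  for sV :: "'k::{field,finite} \<Rightarrow> 'v::ab_group_add \<Rightarrow> 'v" and BV
    and sW :: "'k \<Rightarrow> 'w::ab_group_add \<Rightarrow> 'w" and BW and p s :: nat
begin

abbreviation trace :: "('w \<Rightarrow> 'v) \<Rightarrow> ('v \<Rightarrow> 'w) \<Rightarrow> 'k"
  where "trace X A \<equiv> trace_of sV BV (X \<circ> A)"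

lemma fourier_char_eq: "fourier_char p s sV BV X A = chi (trace X A)"
  by (simp add: fourier_char_def chi_def)

lemma linear_maps_iff': "A \<in> linear_maps sV sW \<longleftrightarrow>
    (\<forall>v w. A (v + w) = A v + A w) \<and> (\<forall>c w. A (sV c w) = sW c (A w))"
  using vector_spaces by (simp add: linear_maps_def Vector_Spaces.linear_iff)

lemma finite_linear_maps': "finite (linear_maps sV sW)"
proof -
  have "finite (PiE (UNIV :: 'v set) (\<lambda>_. UNIV :: 'w set))"
    by (rule finite_PiE[OF V.finite_carrier W.finite_carrier])
  then have "finite (UNIV :: ('v \<Rightarrow> 'w) set)" by (simp add: PiE_UNIV_domain)
  then show ?thesis by (rule finite_subset[OF subset_UNIV])
qed

lemma zero_linear': "(\<lambda>_. 0) \<in> linear_maps sV sW"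
  unfolding linear_maps_iff' by simp

lemma card_linear_maps_pos: "card (linear_maps sV sW) > 0"
  using zero_linear' finite_linear_maps' card_gt_0_iff by blast

lemma mean_eq: "mean sV sW g = (\<Sum>A\<in>linear_maps sV sW. g A) / card (linear_maps sV sW)"
proof -
  have "linear_maps sV sW \<noteq> {}" using zero_linear' by blast
  then show ?thesis unfolding mean_def by (rule integral_pmf_of_set[OF _ finite_linear_maps'])
qed

lemma trace_add_right:
  assumes "X \<in> linear_maps sW sV"
  shows "trace X (\<lambda>v. A v + A' v) = trace X A + trace X A'"
  using assms by (simp add: trace_of_def linear_maps_iff V.rep_add sum.distrib)

lemma trace_combination:
  "trace (\<lambda>w. \<Sum>i\<in>I. sV (c i) (t i w)) A = (\<Sum>i\<in>I. c i * trace (t i) A)"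
  by (simp add: trace_of_def V.rep_sum V.rep_scale sum_distrib_left sum.swap[of _ BV])

lemma trace_surj:
  assumes X: "X \<in> linear_maps sW sV" and "X w0 \<noteq> 0"
  shows "\<exists>A\<in>linear_maps sV sW. trace X A = a"
proof -
  have "\<exists>b0\<in>BV. V.representation BV (X w0) b0 \<noteq> 0"
  proof (rule ccontr)
    assume "\<not> ?thesis"
    then have "(\<Sum>b\<in>BV. sV (V.representation BV (X w0) b) b) = 0" by (intro sum.neutral) simp
    then show False using assms(2) V.sum_rep by simp
  qed
  then obtain b0 where b0: "b0 \<in> BV" "V.representation BV (X w0) b0 \<noteq> 0" by blast
  \<comment> \<open>The witness has rank at most one: it sends \<open>b0\<close> to a multiple of
    \<open>w0\<close> and the other basis vectors to 0. The trace is then a single diagonal entry,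
    and \<open>?c\<close> scales it to \<open>a\<close>.\<close>
  let ?c = "a / V.representation BV (X w0) b0"
  let ?A = "\<lambda>v. sW (?c * V.representation BV v b0) w0"
  have "?A \<in> linear_maps sV sW"
    unfolding linear_maps_iff'
    by (simp add: V.rep_add V.rep_scale W.scale_left_distrib distrib_left mult.left_commute)
  moreover have "trace X ?A = a"
  proof -
    have "trace X ?A = (\<Sum>b\<in>BV. ?c * V.representation BV b b0 * V.representation BV (X w0) b)"
      using X by (simp add: trace_of_def linear_maps_iff V.rep_scale)
    also have "\<dots> = (\<Sum>b\<in>BV. if b = b0 then a else 0)"
      using b0 by (intro sum.cong) (simp_all add: V.representation_basis V.independent_Basis)
    also have "\<dots> = a" using b0(1) V.finite_Basis by simp
    finally show ?thesis .
  qed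
  ultimately show ?thesis by blast
qed

text \<open>If \<open>X\<close> is nonzero, some \<open>A0\<close> has
  \<open>chi (trace X A0) \<noteq> 1\<close>; translation by \<open>A0\<close> multiplies the sum by
  this number and leaves it unchanged, so it is 0.\<close>

lemma sum_chi_trace:
  assumes X: "X \<in> linear_maps sW sV"
  shows "(\<Sum>A\<in>linear_maps sV sW. chi (trace X A))
    = (if \<forall>w. X w = 0 then of_nat (card (linear_maps sV sW)) else 0)"
proof (cases "\<forall>w. X w = 0")
  case True
  then have "V.representation BV (X w) b = 0" for w b by (simp add: V.representation_zero)
  then have "trace X A = 0" for A by (simp add: trace_of_def)
  then show ?thesis using True by (simp add: chi_zero)
next
  case False
  then obtain w0 where "X w0 \<noteq> 0" by blast
  moreover obtain a where a: "chi a \<noteq> 1" using chi_nontrivial by blast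
  ultimately obtain A0 where A0: "A0 \<in> linear_maps sV sW" "trace X A0 = a"
    using trace_surj[OF X] by blast
  let ?S = "\<Sum>A\<in>linear_maps sV sW. chi (trace X A)"
  have "?S = (\<Sum>A\<in>linear_maps sV sW. chi (trace X (\<lambda>v. A v + A0 v)))"
    by (rule sum.reindex_bij_witness[of _ "\<lambda>A v. A v + A0 v" "\<lambda>A v. A v - A0 v"])
      (use A0(1) in \<open>simp_all add: linear_maps_iff' W.scale_right_distrib W.scale_right_diff_distrib\<close>)
  also have "\<dots> = ?S * chi a"
    by (simp add: trace_add_right[OF X] chi_add A0(2) sum_distrib_right)
  finally have "?S * (1 - chi a) = 0" by (simp add: algebra_simps)
  then show ?thesis unfolding if_not_P[OF False] using a by simp
qed

lemma combination_linear:
  assumes "\<And>i. i \<in> I \<Longrightarrow> t i \<in> linear_maps sW sV"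
  shows "(\<lambda>w. \<Sum>i\<in>I. sV (c i) (t i w)) \<in> linear_maps sW sV"
  using assms unfolding linear_maps_iff
  by (simp add: V.scale_right_distrib sum.distrib V.scale_sum_right mult.commute)

text \<open>Parseval for an arbitrary set of frequencies, so that it covers both the image parts and
  the kernel parts.\<close>

lemma norm2_character_sum:
  assumes "\<X> \<subseteq> linear_maps sW sV"
  shows "norm2 sV sW (\<lambda>A. \<Sum>X\<in>\<X>. cf X * fourier_char p s sV BV X A)
    = sqrt (\<Sum>X\<in>\<X>. (cmod (cf X))\<^sup>2)"
proof -
  let ?G = "linear_maps sV sW"
  let ?g = "\<lambda>A. \<Sum>X\<in>\<X>. cf X * fourier_char p s sV BV X A"
  have fin: "finite \<X>" by (rule finite_subset[OF assms finite_linear_maps])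
  have orth: "(\<Sum>A\<in>?G. chi (trace X A) * cnj (chi (trace Y A)))
      = (if X = Y then of_nat (card ?G) else 0)" if "X \<in> \<X>" "Y \<in> \<X>" for X Y
  proof -
    have lin: "X \<in> linear_maps sW sV" "Y \<in> linear_maps sW sV" using assms that by blast+
    then have lin': "(\<lambda>w. X w - Y w) \<in> linear_maps sW sV"
      by (simp add: linear_maps_iff V.scale_right_diff_distrib)
    have tr: "trace (\<lambda>w. X w - Y w) A = trace X A + - trace Y A" for A
      by (simp add: trace_of_def V.representation_diff V.independent_Basis V.span_Basis sum_subtractf)
    have "(\<Sum>A\<in>?G. chi (trace X A) * cnj (chi (trace Y A))) = (\<Sum>A\<in>?G. chi (trace (\<lambda>w. X w - Y w) A))"
      unfolding tr chi_add chi_minus ..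
    then show ?thesis unfolding sum_chi_trace[OF lin'] by (simp add: fun_eq_iff)
  qed
  have "complex_of_real (\<Sum>A\<in>?G. (cmod (?g A))\<^sup>2) = (\<Sum>A\<in>?G. ?g A * cnj (?g A))"
    unfolding of_real_sum complex_norm_square ..
  also have "\<dots> = (\<Sum>A\<in>?G. \<Sum>X\<in>\<X>. \<Sum>Y\<in>\<X>. cf X * cnj (cf Y) * (chi (trace X A) * cnj (chi (trace Y A))))"
    by (simp add: fourier_char_eq sum_product mult_ac)
  also have "\<dots> = (\<Sum>X\<in>\<X>. \<Sum>Y\<in>\<X>. \<Sum>A\<in>?G. cf X * cnj (cf Y) * (chi (trace X A) * cnj (chi (trace Y A))))"
    by (subst sum.swap, rule sum.cong[OF refl], rule sum.swap)
  also have "\<dots> = (\<Sum>X\<in>\<X>. \<Sum>Y\<in>\<X>. if X = Y then cf X * cnj (cf X) * of_nat (card ?G) else 0)"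
    by (intro sum.cong refl) (simp add: orth flip: sum_distrib_left)
  also have "\<dots> = (\<Sum>X\<in>\<X>. cf X * cnj (cf X) * of_nat (card ?G))"
    using fin by simp
  also have "\<dots> = complex_of_real ((\<Sum>X\<in>\<X>. (cmod (cf X))\<^sup>2) * card ?G)"
    unfolding of_real_mult of_real_sum complex_norm_square by (simp add: sum_distrib_right)
  finally have "(\<Sum>A\<in>?G. (cmod (?g A))\<^sup>2) = (\<Sum>X\<in>\<X>. (cmod (cf X))\<^sup>2) * card ?G"
    by (simp only: of_real_eq_iff)
  then show ?thesis using card_linear_maps_pos by (simp add: norm2_def mean_eq)
qed

text \<open>The power \<open>cmod z ^ (2 * r)\<close> is a product of \<open>r\<close> factors
  \<open>z\<close> and \<open>r\<close> factors \<open>cnj z\<close>; conjugating a character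
  negates its frequency.\<close>

definition sign :: "nat \<Rightarrow> nat \<Rightarrow> 'k"
  where "sign r i = (if i < r then 1 else - 1)"

lemma mean_power_character_sum_le:
  fixes \<X> k r
  assumes sub: "\<X> \<subseteq> linear_maps sW sV" and k: "k = 2 * r"
  defines "\<T> \<equiv> {t \<in> {..<k} \<rightarrow>\<^sub>E \<X>. \<forall>w. (\<Sum>i<k. sV (sign r i) (t i w)) = 0}"
  shows "mean sV sW (\<lambda>A. cmod (\<Sum>X\<in>\<X>. cf X * fourier_char p s sV BV X A) ^ k)
    \<le> (\<Sum>t\<in>\<T>. \<Prod>i<k. cmod (cf (t i)))"
proof -
  let ?G = "linear_maps sV sW"
  let ?g = "\<lambda>A. \<Sum>X\<in>\<X>. cf X * fourier_char p s sV BV X A"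
  let ?P = "{..<k} \<rightarrow>\<^sub>E \<X>"
  define e where "e i X = (if i < r then cf X else cnj (cf X))" for i X
  let ?Z = "\<lambda>t w. \<Sum>i<k. sV (sign r i) (t i w)"
  have fin: "finite \<X>" by (rule finite_subset[OF sub finite_linear_maps])
  have finP: "finite ?P" using fin by (intro finite_PiE) simp_all
  have linZ: "?Z t \<in> linear_maps sW sV" if t: "t \<in> ?P" for t
    by (rule combination_linear) (rule subsetD[OF sub PiE_mem[OF t]])
  have factor: "(\<Sum>X\<in>\<X>. e i X * chi (sign r i * trace X A)) = (if i < r then ?g A else cnj (?g A))" for i A
    by (simp add: e_def sign_def fourier_char_eq chi_minus)
  have split: "(\<Prod>i<k. if i < r then z else cnj z) = complex_of_real (cmod z ^ k)" for z
  proof -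
    have "(\<Prod>i<r + m. if i < r then z else cnj z) = z ^ r * cnj z ^ m" for m
      by (induction m) (simp_all cong: prod.cong_simp)
    from this[of r] have "(\<Prod>i<k. if i < r then z else cnj z) = (z * cnj z) ^ r"
      unfolding k mult_2 power_mult_distrib .
    also have "\<dots> = complex_of_real (cmod z ^ k)"
      unfolding complex_norm_square[symmetric] by (simp add: k power_mult)
    finally show ?thesis .
  qed
  have expand: "complex_of_real (cmod (?g A) ^ k) = (\<Sum>t\<in>?P. (\<Prod>i<k. e i (t i)) * chi (trace (?Z t) A))" for A
  proof -
    have "complex_of_real (cmod (?g A) ^ k) = (\<Prod>i<k. \<Sum>X\<in>\<X>. e i X * chi (sign r i * trace X A))"
      unfolding factor split ..
    also have "\<dots> = (\<Sum>t\<in>?P. \<Prod>i<k. e i (t i) * chi (sign r i * trace (t i) A))"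
      by (rule prod_sum_PiE) (simp_all add: fin)
    also have "\<dots> = (\<Sum>t\<in>?P. (\<Prod>i<k. e i (t i)) * chi (trace (?Z t) A))"
      unfolding trace_combination chi_sum prod.distrib ..
    finally show ?thesis .
  qed
  have "complex_of_real (\<Sum>A\<in>?G. cmod (?g A) ^ k)
      = (\<Sum>t\<in>?P. \<Sum>A\<in>?G. (\<Prod>i<k. e i (t i)) * chi (trace (?Z t) A))"
    unfolding of_real_sum expand by (rule sum.swap)
  also have "\<dots> = (\<Sum>t\<in>?P. if \<forall>w. ?Z t w = 0 then (\<Prod>i<k. e i (t i)) * of_nat (card ?G) else 0)"
    by (intro sum.cong refl) (simp add: sum_chi_trace[OF linZ] flip: sum_distrib_left)
  also have "\<dots> = (\<Sum>t\<in>\<T>. (\<Prod>i<k. e i (t i)) * of_nat (card ?G))"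
    unfolding \<T>_def by (rule sum.inter_filter[OF finP, symmetric])
  finally have eq: "complex_of_real (\<Sum>A\<in>?G. cmod (?g A) ^ k)
      = (\<Sum>t\<in>\<T>. (\<Prod>i<k. e i (t i)) * of_nat (card ?G))" .
  \<comment> \<open>The moment is real and nonnegative, hence equals the modulus of the complex
    expansion, to which the triangle inequality applies.\<close>
  have "0 \<le> (\<Sum>A\<in>?G. cmod (?g A) ^ k)" by (intro sum_nonneg zero_le_power norm_ge_zero)
  then have "(\<Sum>A\<in>?G. cmod (?g A) ^ k) = cmod (\<Sum>t\<in>\<T>. (\<Prod>i<k. e i (t i)) * of_nat (card ?G))"
    unfolding eq[symmetric] norm_of_real by (rule abs_of_nonneg[symmetric])
  also have "\<dots> \<le> (\<Sum>t\<in>\<T>. cmod ((\<Prod>i<k. e i (t i)) * of_nat (card ?G)))" by (rule norm_sum)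
  also have "\<dots> = (\<Sum>t\<in>\<T>. (\<Prod>i<k. cmod (cf (t i)))) * card ?G"
  proof -
    have "cmod (e i X) = cmod (cf X)" for i X by (simp add: e_def)
    then show ?thesis by (simp add: norm_mult prod_norm[symmetric] sum_distrib_right)
  qed
  finally show ?thesis
    using card_linear_maps_pos by (simp add: mean_eq divide_le_eq)
qed

end

section \<open>The bound\<close>

context matrix_fourier
begin

text \<open>Each map is replaced by one chosen factorisation, which turns a vanishing signed sum of
  maps into a relation between two tables. The right-hand sums of
  \<open>sum_related_tables_le\<close> run over all factorisations; the factor
  \<open>CARD('k) ^ (d * d)\<close> pays for passing back to subspaces.\<close>

lemma sum_rank_tuples_le:
  fixes F :: "('w \<Rightarrow> 'v) \<Rightarrow> real" and k d M r :: nat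
  defines "N \<equiv> k * d"
  assumes k: "k \<ge> 4" and M: "V.dim (UNIV :: 'v set) \<le> M" "W.dim (UNIV :: 'w set) \<le> M"
    and nonneg: "\<And>X. 0 \<le> F X"
  defines "\<T> \<equiv> {t \<in> {..<k} \<rightarrow>\<^sub>E {X \<in> linear_maps sW sV. rank_of sV X = d}.
    \<forall>w. (\<Sum>i<k. sV (sign r i) (t i w)) = 0}"
  shows "(\<Sum>t\<in>\<T>. \<Prod>i<k. F (t i))
    \<le> 2 ^ N * real CARD('k) ^ (N * N)
      * (real k * real CARD('k) powr ((3 * real k / 4 - 1) * real d * real M)
      * (real CARD('k) ^ (d * d)
        * ((\<Sum>S | V.subspace S \<and> V.dim S = d.
              sqrt (\<Sum>X | X \<in> linear_maps sW sV \<and> range X = S. (F X)\<^sup>2) ^ k)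
          + (\<Sum>S | W.subspace S \<and> W.dim S + d = W.dim (UNIV :: 'w set).
              sqrt (\<Sum>X | X \<in> linear_maps sW sV \<and> {w. X w = 0} = S. (F X)\<^sup>2) ^ k))))"
proof -
  let ?R = "{X \<in> linear_maps sW sV. rank_of sV X = d}"
  \<comment> \<open>Setting the weight to 0 off independent tensors supplies the support conditions
    of \<open>sum_related_tables_le\<close>.\<close>
  define a where "a x y = (if independent_tensor d x y then F (tensor d x y) else 0)" for x y
  have "\<forall>X\<in>?R. \<exists>xy. fst xy \<in> V.tuples d \<and> snd xy \<in> W.tuples d
      \<and> independent_tensor d (fst xy) (snd xy) \<and> tensor d (fst xy) (snd xy) = X"
  proof
    fix X assume "X \<in> ?R"
    then have "X \<in> linear_maps sW sV" "rank_of sV X = d" by simp_all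
    from rank_factorization[OF this] obtain x where x: "x \<in> V.tuples d"
      and ex: "\<exists>y\<in>W.tuples d. independent_tensor d x y \<and> tensor d x y = X" by (rule bexE)
    from ex obtain y where y: "y \<in> W.tuples d" "independent_tensor d x y \<and> tensor d x y = X" by (rule bexE)
    show "\<exists>xy. fst xy \<in> V.tuples d \<and> snd xy \<in> W.tuples d
      \<and> independent_tensor d (fst xy) (snd xy) \<and> tensor d (fst xy) (snd xy) = X"
      by (rule exI[of _ "(x, y)"]) (simp only: fst_conv snd_conv x y simp_thms)
  qed
  from bchoice[OF this] obtain h where h: "\<forall>X\<in>?R. fst (h X) \<in> V.tuples d \<and> snd (h X) \<in> W.tuples d
      \<and> independent_tensor d (fst (h X)) (snd (h X)) \<and> tensor d (fst (h X)) (snd (h X)) = X" ..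
  have hx: "fst (h X) \<in> V.tuples d" and hy: "snd (h X) \<in> W.tuples d"
    and hind: "independent_tensor d (fst (h X)) (snd (h X))"
    and ht: "tensor d (fst (h X)) (snd (h X)) = X" if "X \<in> ?R" for X
    using bspec[OF h that] by simp_all
  define H where "H t = (\<lambda>i\<in>{..<k}. fst (h (t i)), \<lambda>i\<in>{..<k}. snd (h (t i)))" for t
  have tP: "t \<in> {..<k} \<rightarrow>\<^sub>E ?R" if "t \<in> \<T>" for t
    using that unfolding \<T>_def mem_Collect_eq by (rule conjunct1)
  have tR: "t i \<in> ?R" if "t \<in> \<T>" "i < k" for t i
    using tP[OF that(1)] by (rule PiE_mem) (simp only: lessThan_iff that(2))
  \<comment> \<open>The tensor of the chosen factorisation recovers the map, so no two tuples share
    a pair of tables.\<close>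
  have injH: "inj_on H \<T>"
  proof (rule inj_onI)
    fix t t' assume t: "t \<in> \<T>" "t' \<in> \<T>" and eq: "H t = H t'"
    have "t i = t' i" if i: "i < k" for i
    proof -
      have H: "fst (H t) i = fst (h (t i))" "snd (H t) i = snd (h (t i))" for t
        using i by (simp_all add: H_def)
      have "t i = tensor d (fst (H t) i) (snd (H t) i)"
        unfolding H by (rule ht[OF tR[OF t(1) i], symmetric])
      also have "\<dots> = t' i"
        unfolding eq H by (rule ht[OF tR[OF t(2) i]])
      finally show ?thesis .
    qed
    then show "t = t'" by (intro PiE_ext[OF tP[OF t(1)] tP[OF t(2)]]) (simp only: lessThan_iff)
  qed
  have aH: "a (fst (H t) i) (snd (H t) i) = F (t i)" if "t \<in> \<T>" "i < k" for t i
    using that(2) hind[OF tR[OF that]] ht[OF tR[OF that]] by (simp add: a_def H_def)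
  let ?A = "\<Sum>x\<in>V.tuples d. sqrt (\<Sum>y\<in>W.tuples d. (a x y)\<^sup>2) ^ k"
  let ?B = "\<Sum>y\<in>W.tuples d. sqrt (\<Sum>x\<in>V.tuples d. (a x y)\<^sup>2) ^ k"
  let ?q = "real CARD('k)"
  let ?C = "real k * ?q powr ((3 * real k / 4 - 1) * real d * real M)"
  let ?NV = "\<lambda>S. sqrt (\<Sum>X | X \<in> linear_maps sW sV \<and> range X = S. (F X)\<^sup>2) ^ k"
  let ?NW = "\<lambda>S. sqrt (\<Sum>X | X \<in> linear_maps sW sV \<and> {w. X w = 0} = S. (F X)\<^sup>2) ^ k"
  have a0: "0 \<le> a x y" for x y using nonneg by (simp add: a_def)
  have k0: "k > 0" using k by simp
  have N0: "0 \<le> ?NV S" "0 \<le> ?NW S'" for S S' by (simp_all add: sum_nonneg)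
  have "(\<Sum>t\<in>\<T>. \<Prod>i<k. F (t i)) = (\<Sum>(T, S)\<in>H ` \<T>. \<Prod>i<k. a (T i) (S i))"
    unfolding sum.reindex[OF injH] by (intro sum.cong refl) (simp add: case_prod_unfold aH)
  also have "\<dots> \<le> 2 ^ N * ?q ^ (N * N) * (?C * (?A + ?B))"
    unfolding N_def
  proof (rule sum_related_tables_le[OF k, where c = "sign r"])
    show "sign r i \<noteq> 0" for i by (simp add: sign_def)
    show "V.indep_family d x" "W.indep_family d y" if "a x y \<noteq> 0" for x y
      using that by (auto simp: a_def independent_tensor_def split: if_splits)
    show "H ` \<T> \<subseteq> V.tables k d \<times> W.tables k d"
    proof (rule image_subsetI)
      fix t assume t: "t \<in> \<T>"
      show "H t \<in> V.tables k d \<times> W.tables k d"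
        unfolding H_def using hx[OF tR[OF t]] hy[OF tR[OF t]]
        by (intro SigmaI restrict_PiE_iff[THEN iffD2] ballI) (simp_all only: lessThan_iff)
    qed
    show "(\<Sum>i<k. \<Sum>j<d. sV (sign r i * W.pairing (S i j) w) (T i j)) = 0"
      if TS: "(T, S) \<in> H ` \<T>" for T S w
    proof -
      obtain t where t: "t \<in> \<T>" and "(T, S) = H t" using TS by (rule imageE)
      then have T: "T i = fst (h (t i))" and S: "S i = snd (h (t i))" if "i < k" for i
        using that by (simp_all add: H_def)
      have "(\<Sum>j<d. sV (sign r i * W.pairing (S i j) w) (T i j)) = sV (sign r i) (t i w)"
        if i: "i < k" for i
      proof -
        have "(\<Sum>j<d. sV (sign r i * W.pairing (S i j) w) (T i j)) = sV (sign r i) (tensor d (T i) (S i) w)"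
          by (simp add: tensor_def V.scale_sum_right)
        then show ?thesis by (simp only: T[OF i] S[OF i] ht[OF tR[OF t i]])
      qed
      then have "(\<Sum>i<k. \<Sum>j<d. sV (sign r i * W.pairing (S i j) w) (T i j))
          = (\<Sum>i<k. sV (sign r i) (t i w))" by (intro sum.cong) simp_all
      also have "\<dots> = 0" using t unfolding \<T>_def by simp
      finally show ?thesis .
    qed
  qed (use M a0 in simp_all)
  also have "?A + ?B \<le> ?q ^ (d * d) * (\<Sum>S | V.subspace S \<and> V.dim S = d. ?NV S)
      + ?q ^ (d * d) * (\<Sum>S | W.subspace S \<and> W.dim S + d = W.dim (UNIV :: 'w set). ?NW S)"
  proof (rule add_mono)
    have sqA: "(\<Sum>y\<in>W.tuples d. (a x y)\<^sup>2)
        = (\<Sum>y | y \<in> W.tuples d \<and> independent_tensor d x y. (F (tensor d x y))\<^sup>2)" for x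
      unfolding sum.inter_filter[OF W.finite_tuples] by (intro sum.cong refl) (simp add: a_def)
    have zeroA: "sqrt (\<Sum>y\<in>W.tuples d. (a x y)\<^sup>2) ^ k = 0" if "\<not> V.indep_family d x" for x
      using that k0 by (simp add: a_def independent_tensor_def power_0_left)
    have "?A = (\<Sum>x | x \<in> V.tuples d \<and> V.indep_family d x. sqrt (\<Sum>y\<in>W.tuples d. (a x y)\<^sup>2) ^ k)"
      unfolding sum.inter_filter[OF V.finite_tuples] by (intro sum.cong refl) (simp add: zeroA)
    also have "\<dots> \<le> (\<Sum>x | x \<in> V.tuples d \<and> V.indep_family d x. ?NV (V.span (x ` {..<d})))"
      unfolding sqA
      by (intro sum_mono power_mono real_sqrt_le_mono sum_independent_tensor_image_le) (simp_all add: sum_nonneg)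
    also have "\<dots> \<le> ?q ^ (d * d) * (\<Sum>S | V.subspace S \<and> V.dim S = d. ?NV S)"
      by (rule sum_span_le) (rule N0)
    finally show "?A \<le> \<dots>" .
    have sqB: "(\<Sum>x\<in>V.tuples d. (a x y)\<^sup>2)
        = (\<Sum>x | x \<in> V.tuples d \<and> independent_tensor d x y. (F (tensor d x y))\<^sup>2)" for y
      unfolding sum.inter_filter[OF V.finite_tuples] by (intro sum.cong refl) (simp add: a_def)
    have zeroB: "sqrt (\<Sum>x\<in>V.tuples d. (a x y)\<^sup>2) ^ k = 0" if "\<not> (\<exists>x. independent_tensor d x y)" for y
      using that k0 by (simp add: a_def power_0_left)
    have "?B = (\<Sum>y | y \<in> W.tuples d \<and> (\<exists>x. independent_tensor d x y).
        sqrt (\<Sum>x\<in>V.tuples d. (a x y)\<^sup>2) ^ k)"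
      unfolding sum.inter_filter[OF W.finite_tuples] by (intro sum.cong refl) (simp add: zeroB)
    also have "\<dots> \<le> (\<Sum>y | y \<in> W.tuples d \<and> (\<exists>x. independent_tensor d x y).
        ?NW {w. \<forall>j<d. W.pairing (y j) w = 0})"
      unfolding sqB
      by (intro sum_mono power_mono real_sqrt_le_mono sum_independent_tensor_kernel_le) (simp_all add: sum_nonneg)
    also have "\<dots> \<le> ?q ^ (d * d)
        * (\<Sum>S | W.subspace S \<and> W.dim S + d = W.dim (UNIV :: 'w set). ?NW S)"
      by (rule sum_kernel_le) (rule N0)
    finally show "?B \<le> \<dots>" .
  qed
  finally show ?thesis by (simp add: distrib_left mult_left_mono)
qed

end

text \<open>The power of 2 is absorbed into \<open>q ^ (k * d)\<close>. The exponents then sum to at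
  most twice the square of \<open>k * d\<close>, and this is at most
  \<open>k ^ 3 * d ^ 2 / 2\<close> because \<open>k \<ge> 4\<close>. The remaining factor
  \<open>k\<close> is covered by \<open>k ^ 7 * d ^ 6\<close>, which uses
  \<open>d \<ge> 1\<close>.\<close>

lemma pattern_count_le:
  fixes q k d :: nat
  assumes "k \<ge> 4" "d \<ge> 1" "q \<ge> 2"
  shows "2 ^ (k * d) * real q ^ (k * d * (k * d)) * real k * real q ^ (d * d)
    \<le> real k ^ 7 * real d ^ 6 * real q powr (real k ^ 3 * real d ^ 2 / 2)"
proof -
  have "2 ^ (k * d) * real q ^ (k * d * (k * d)) * real q ^ (d * d)
      \<le> real q ^ (k * d) * real q ^ (k * d * (k * d)) * real q ^ (d * d)"
    using assms by (intro mult_right_mono power_mono) simp_all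
  also have "\<dots> = real q powr real (k * d + k * d * (k * d) + d * d)"
    by (subst powr_realpow) (use assms in \<open>simp_all add: power_add\<close>)
  also have "\<dots> \<le> real q powr (real k ^ 3 * real d ^ 2 / 2)"
  proof (rule powr_mono)
    \<comment> \<open>Used with \<open>e = k * d * d\<close>, which dominates both
      \<open>k * d\<close> and \<open>d * d\<close> and is at most a quarter of the main
      term.\<close>
    have arith: "2 * (a + b + c) \<le> 4 * b" if "a \<le> e" "c \<le> e" "4 * e \<le> b" for a b c e :: nat
      using that by simp
    have "4 * (k * d * d) \<le> k * (k * d * d)" using assms(1) by (rule mult_le_mono1)
    then have "4 * (k * d * d) \<le> k * d * (k * d)" by (simp only: mult_ac)
    then have "2 * (k * d + k * d * (k * d) + d * d) \<le> 4 * (k * d * (k * d))"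
      using assms by (intro arith[of _ "k * d * d"]) simp_all
    also have "\<dots> = 4 * (k * (k * d * d))" by (simp only: mult_ac)
    also have "\<dots> \<le> k * (k * (k * d * d))" using assms(1) by (rule mult_le_mono1)
    finally have "real (2 * (k * d + k * d * (k * d) + d * d)) \<le> real (k * (k * (k * d * d)))"
      by (simp only: of_nat_le_iff)
    then show "real (k * d + k * d * (k * d) + d * d) \<le> real k ^ 3 * real d ^ 2 / 2"
      by (simp add: power2_eq_square power3_eq_cube mult_ac)
  qed (use assms in simp)
  finally have *: "2 ^ (k * d) * real q ^ (k * d * (k * d)) * real q ^ (d * d)
      \<le> real q powr (real k ^ 3 * real d ^ 2 / 2)" .
  have "real k * 1 \<le> real k ^ 7 * real d ^ 6"
    using assms by (intro mult_mono self_le_power one_le_power) simp_all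
  from mult_mono[OF this *] show ?thesis by (simp add: mult_ac)
qed

theorem proposition4:
  fixes sV :: "'k::{field,finite} \<Rightarrow> 'v::ab_group_add \<Rightarrow> 'v"
    and sW :: "'k \<Rightarrow> 'w::ab_group_add \<Rightarrow> 'w"
    and BV :: "'v set" and BW :: "'w set"
    and f :: "('v \<Rightarrow> 'w) \<Rightarrow> complex"
    and p s q m n d k :: nat
  assumes "prime p" and "q = p ^ s" and "CARD('k) = q"
    and "finite_dimensional_vector_space sV BV"
    and "finite_dimensional_vector_space sW BW"
    and "m = vector_space.dim sV (UNIV :: 'v set)"
    and "n = vector_space.dim sW (UNIV :: 'w set)"
    and "d \<ge> 1"
    and "fourier_degree p s sV BV sW f = d"
    and "k \<ge> 4" and "even k"
  shows "mean sV sW (\<lambda>A. cmod (level_part p s sV BV sW d f A) ^ k)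
    \<le> real k ^ 7 * real d ^ 6
      * real q powr (real k ^ 3 * real d ^ 2 / 2)
      * real q powr ((3 * real k / 4 - 1) * real d * real (max m n))
      * ((\<Sum>V' | module.subspace sV V' \<and> vector_space.dim sV V' = d.
            norm2 sV sW (image_part p s sV BV sW V' f) ^ k)
        + (\<Sum>W' | module.subspace sW W' \<and> vector_space.dim sW W' + d = n.
            norm2 sV sW (kernel_part p s sV BV sW W' f) ^ k))"
proof -
  interpret matrix_fourier sV BV sW BW p s
  proof -
    interpret V: finite_dimensional_vector_space sV BV by (rule assms(4))
    interpret W: finite_dimensional_vector_space sW BW by (rule assms(5))
    show "matrix_fourier sV BV sW BW p s" by unfold_locales (use assms in simp_all)
  qed
  obtain r where r: "k = 2 * r" using assms(11) by (rule evenE)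
  let ?cf = "fourier_coeff p s sV BV sW f"
  let ?M = "max m n"
  have qk: "CARD('k) = q" by (rule assms(3))
  have "card {0, 1 :: 'k} \<le> CARD('k)" by (rule card_mono) simp_all
  then have q2: "q \<ge> 2" using qk by simp
  \<comment> \<open>Parseval rewrites the norms on the right as coefficient sums, the form in which
    the counting bound delivers them.\<close>
  have img: "norm2 sV sW (image_part p s sV BV sW S f)
      = sqrt (\<Sum>X | X \<in> linear_maps sW sV \<and> range X = S. (cmod (?cf X))\<^sup>2)" for S
    unfolding image_part_def by (rule norm2_character_sum) blast
  have ker: "norm2 sV sW (kernel_part p s sV BV sW S f)
      = sqrt (\<Sum>X | X \<in> linear_maps sW sV \<and> {w. X w = 0} = S. (cmod (?cf X))\<^sup>2)" for S
    unfolding kernel_part_def by (rule norm2_character_sum) blast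
  let ?S = "(\<Sum>V' | module.subspace sV V' \<and> vector_space.dim sV V' = d.
            norm2 sV sW (image_part p s sV BV sW V' f) ^ k)
        + (\<Sum>W' | module.subspace sW W' \<and> vector_space.dim sW W' + d = n.
            norm2 sV sW (kernel_part p s sV BV sW W' f) ^ k)"
  let ?E = "real q powr ((3 * real k / 4 - 1) * real d * real ?M)"
  have S0: "0 \<le> ?S" unfolding img ker by (intro add_nonneg_nonneg sum_nonneg) (simp_all add: sum_nonneg)
  have "mean sV sW (\<lambda>A. cmod (level_part p s sV BV sW d f A) ^ k)
      \<le> (\<Sum>t | t \<in> {..<k} \<rightarrow>\<^sub>E {X \<in> linear_maps sW sV. rank_of sV X = d}
            \<and> (\<forall>w. (\<Sum>i<k. sV (sign r i) (t i w)) = 0). \<Prod>i<k. cmod (?cf (t i)))"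
    unfolding level_part_def by (rule mean_power_character_sum_le[OF _ r]) blast
  also have "\<dots> \<le> 2 ^ (k * d) * real q ^ (k * d * (k * d))
      * (real k * ?E * (real q ^ (d * d) * ?S))"
    unfolding img ker assms(7) qk[symmetric]
    by (rule sum_rank_tuples_le) (use assms(6,7,10) in simp_all)
  also have "\<dots> = (2 ^ (k * d) * real q ^ (k * d * (k * d)) * real k * real q ^ (d * d)) * (?E * ?S)"
    by (simp only: mult_ac)
  also have "\<dots> \<le> real k ^ 7 * real d ^ 6 * real q powr (real k ^ 3 * real d ^ 2 / 2) * (?E * ?S)"
    by (intro mult_right_mono pattern_count_le assms q2 mult_nonneg_nonneg S0) simp
  finally show ?thesis by (simp only: mult.assoc)
qed

end
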